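(* Let $\Omega\subset\mathbb{R}^d$ be a bounded domain admitting $2$-frames. For any invertible real $d\times d$ matrix $T$, $$\Lambda(T(\Omega))\le\frac{\|T^{-1}\|_2^4+2\|T^{-1}\|_4^4}{(d+2)\|T^{-1}\|_2^2}\,\Lambda(\Omega).$$ Equivalently, the quantity $$\Lambda(T(\Omega))\,V(T(\Omega))^{2/d}\cdot\frac{V(T^{-1}(\Omega))^{2/d}\,I_2(T^{-1}(\Omega))}{I_4(T^{-1}(\Omega))}$$ is maximal when $T$ is a multiple of an orthogonal matrix.
   Context: $G_\Omega=\{U\in O(d):U(\Omega)=\Omega\}$; $\Omega$ admits $2$-frames if every $G_\Omega$-invariant homogeneous polynomial of degree $4$ on $\mathbb{R}^d$ is a scalar multiple of $|x|^4$. $\|T\|_n=(\sum_is_i^n)^{1/n}$ is the Schatten norm ($s_i$ singular values). $V(D)$ is volume, $I_{2p}(D)=\int_D|x|^{2p}dx$. The buckling eigenvalue is $\Lambda(D)=\inf\{\int_D|\Delta u|^2/\int_D|\nabla u|^2:u\in H^2_0(D)\setminus\{0\}\}$, the principal eigenvalue of $\Delta^2u+\Lambda\Delta u=0$ in $D$, $u=\partial u/\partial\nu=0$ on $\partial D$. *)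

theory Defs
  imports "HOL-Analysis.Analysis"
begin

definition bounded_domain :: "(real^'n) set \<Rightarrow> bool" where
  "bounded_domain \<Omega> \<longleftrightarrow> open \<Omega> \<and> connected \<Omega> \<and> bounded \<Omega> \<and> \<Omega> \<noteq> {}"

definition sym_group :: "(real^'n) set \<Rightarrow> (real^'n^'n) set" where
  "sym_group \<Omega> = {U. orthogonal_matrix U \<and> (\<lambda>x. U *v x) ` \<Omega> = \<Omega>}"

definition hom_poly4 :: "('n::finite \<Rightarrow> 'n \<Rightarrow> 'n \<Rightarrow> 'n \<Rightarrow> real) \<Rightarrow> real^'n \<Rightarrow> real" where
  "hom_poly4 c x = (\<Sum>i\<in>UNIV. \<Sum>j\<in>UNIV. \<Sum>k\<in>UNIV. \<Sum>l\<in>UNIV.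
        c i j k l * (x$i) * (x$j) * (x$k) * (x$l))"

definition admits_2_frames :: "(real^'n) set \<Rightarrow> bool" where
  "admits_2_frames \<Omega> \<longleftrightarrow>
     (\<forall>c. (\<forall>U\<in>sym_group \<Omega>. \<forall>x. hom_poly4 c (U *v x) = hom_poly4 c x)
          \<longrightarrow> (\<exists>a::real. \<forall>x. hom_poly4 c x = a * norm x ^ 4))"

text \<open>For even n, sum_i s_i^n = trace((A^T A)^(n/2)), where s_i are the singular values.\<close>
definition schatten2 :: "real^'n^'n \<Rightarrow> real" where
  "schatten2 A = sqrt (trace (transpose A ** A))"

definition schatten4 :: "real^'n^'n \<Rightarrow> real" where
  "schatten4 A = root 4 (trace ((transpose A ** A) ** (transpose A ** A)))"

text \<open>Test functions: C^2 functions with compact support contained in D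
  (dense in H^2_0(D), so the infimum is the same).  g is the gradient, H the Hessian.\<close>
definition C2_test :: "(real^'n) set \<Rightarrow> (real^'n \<Rightarrow> real) \<Rightarrow> (real^'n \<Rightarrow> real^'n)
     \<Rightarrow> (real^'n \<Rightarrow> real^'n^'n) \<Rightarrow> bool" where
  "C2_test D u g H \<longleftrightarrow>
     (\<forall>x. (u has_derivative (\<lambda>h. g x \<bullet> h)) (at x)) \<and>
     (\<forall>x. (g has_derivative (\<lambda>h. H x *v h)) (at x)) \<and>
     continuous_on UNIV H \<and>
     compact (closure {x. u x \<noteq> 0}) \<and> closure {x. u x \<noteq> 0} \<subseteq> D"

definition buckling :: "(real^'n) set \<Rightarrow> real" where
  "buckling D = Inf {integral UNIV (\<lambda>x. (trace (H x))\<^sup>2) / integral UNIV (\<lambda>x. (norm (g x))\<^sup>2)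
        | u g H. C2_test D u g H \<and> (\<exists>x. u x \<noteq> 0)}"

end

(* Averaging the test functions u(U T^-1 y) over the symmetries U of Omega proves the theorem; the
   average is replaced by a fixed point, so that no Haar measure is needed.
   With S = T^-1 (T^-1)^t and R = U S U^t, the Rayleigh quotient of u(U T^-1 y) is
   int tr(R D^2 u)^2 / int <Du, R Du>, so Lambda(T Omega) int <Du, R Du> <= int tr(R D^2 u)^2.
   Since int u_ij u_kl is totally symmetric in i, j, k, l, the right-hand side only depends on the
   symmetrization of the tensor R_ij R_kl, and the inequality is linear in the pair
   (R, symmetrization of R x R). It therefore persists on the closed convex hull of these pairs.
   The point of minimal norm of the hull is invariant under the symmetry group, so the 2-frame
   property makes its components multiples of the identity and of the symmetrization of
   delta_ij delta_kl; the multiples are found by taking traces, which are constant on the hull. *)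

theory Submission
  imports Defs
begin

section \<open>Invariant points of convex hulls\<close>

text \<open>Polynomials only see totally symmetric tensors, so the 2-frame property says nothing
  about R \<otimes> R itself. What permits passing to its symmetrization is an integration by parts:
  int u_ij u_kl is unchanged when j and l are exchanged, and the symmetry of the Hessian then gives
  all permutations. The functions u(U T^-1 y) are admissible on T \<Omega> because U^t preserves
  \<Omega>, so their supports lie in T U^t \<Omega> = T \<Omega>. The Jacobian of the substitution
  multiplies both integrals of the Rayleigh quotient and drops out. Origin of the constant, in
  dimension d: on the orbit tr R = tr S, and contracting the sum of the three index pairings of R
  \<otimes> R gives (tr S)^2 + 2 tr S^2. For R = 1 these numbers are d and d^2 + 2 d. Averaging
  therefore replaces R by a 1 with a = tr S / d, and the pairings of R by b times those of the
  identity with b = ((tr S)^2 + 2 tr S^2) / (d (d + 2)). The factor in the theorem is b / a, since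
  tr S and tr S^2 are the Schatten expressions |T^-1|_2^2 and |T^-1|_4^4.\<close>

lemma invariant_point_of_hull:
  fixes C :: "'a::euclidean_space set"
  assumes "C \<noteq> {}" 
    and lin: "\<And>f. f \<in> F \<Longrightarrow> linear f"
    and iso: "\<And>f x. f \<in> F \<Longrightarrow> norm (f x) = norm x"
    and inv: "\<And>f. f \<in> F \<Longrightarrow> f ` C \<subseteq> C"
  obtains a where "a \<in> closure (convex hull C)" "\<And>f. f \<in> F \<Longrightarrow> f a = a"
proof -
  define K where "K = closure (convex hull C)"
  have K: "closed K" "convex K" "K \<noteq> {}"
    using assms(1) by (auto simp: K_def convex_closure)
  define a where "a = closest_point K 0"
  have a: "a \<in> K" "\<And>z. z \<in> K \<Longrightarrow> norm a \<le> norm z"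
    using closest_point_exists[OF K(1,3), of 0] by (auto simp: a_def)
  have "f a = a" if f: "f \<in> F" for f
  proof -
    have "f ` K \<subseteq> closure (f ` (convex hull C))"
      unfolding K_def using lin[OF f] by (rule closure_linear_image_subset)
    also have "f ` (convex hull C) = convex hull (f ` C)"
      using lin[OF f] by (simp add: convex_hull_linear_image)
    also have "closure (convex hull (f ` C)) \<subseteq> K"
      unfolding K_def by (intro closure_mono hull_mono inv f)
    finally have "f a \<in> K" using a(1) by blast
    \<comment> \<open>Being norm preserving, \<open>f\<close> sends the nearest point of
      \<open>K\<close> to another nearest point, and a closed convex set has only one.\<close>
    then have "f a = closest_point K 0"
      using a(2) iso[OF f] by (intro closest_point_unique K) auto
    then show ?thesis by (simp add: a_def)
  qed
  then show ?thesis using that a(1) by (auto simp: K_def)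
qed

text \<open>Carries linear inequalities, and through the next lemma linear equations, from an orbit
  to the averaged point: a half-space is closed and convex.\<close>

lemma linear_le_on_closed_hull:
  fixes h :: "'a::euclidean_space \<Rightarrow> real"
  assumes "linear h" "\<And>c. c \<in> C \<Longrightarrow> h c \<le> b" "a \<in> closure (convex hull C)"
  shows "h a \<le> b"
proof -
  have "closed {x. h x \<le> b}"
    by (intro closed_Collect_le continuous_on_const linear_continuous_on linear_linear[THEN iffD1]
        assms)
       (simp add: assms(1) linear_conv_bounded_linear[symmetric])
  moreover have "convex {x. h x \<le> b}"
    using convex_linear_vimage[OF assms(1), of "{..b}"] by (simp add: vimage_def)
  ultimately have "closure (convex hull C) \<subseteq> {x. h x \<le> b}"
    using assms(2) by (intro closure_minimal hull_minimal) auto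
  then show ?thesis using assms(3) by auto
qed

lemma linear_eq_on_closed_hull:
  fixes h :: "'a::euclidean_space \<Rightarrow> real"
  assumes "linear h" "\<And>c. c \<in> C \<Longrightarrow> h c = b" "a \<in> closure (convex hull C)"
  shows "h a = b"
proof (rule antisym)
  show "h a \<le> b"
    by (rule linear_le_on_closed_hull[OF assms(1) _ assms(3)]) (simp add: assms(2))
  have "- h a \<le> - b"
    by (rule linear_le_on_closed_hull[OF linear_compose_neg[OF assms(1)] _ assms(3)])
      (simp add: assms(2))
  then show "b \<le> h a" by simp
qed

section \<open>Tensors of order two and four\<close>

text \<open>A nested vector is read as a tensor whose first factor is the outer index, and this map
  is U \<otimes> f. Nesting it yields the group action on tensors of any order, and the norm of
  nested vectors is already the Frobenius norm.\<close>

definition tens_map :: "real^'n^'n \<Rightarrow> ('b \<Rightarrow> 'c::real_vector) \<Rightarrow> 'b^'n \<Rightarrow> 'c^'n" where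
  "tens_map U f v = (\<chi> i. \<Sum>a\<in>UNIV. U$i$a *\<^sub>R f (v$a))"

text \<open>Contraction of the outermost index; repeated, it evaluates a tensor as a multilinear
  form.\<close>

definition contr :: "real^'n \<Rightarrow> 'b::real_vector^'n \<Rightarrow> 'b" where
  "contr x v = (\<Sum>i\<in>UNIV. x$i *\<^sub>R v$i)"

lemma linear_tens_map:
  assumes "linear f"
  shows "linear (tens_map U f)"
  by (rule linearI) (auto simp: tens_map_def vec_eq_iff linear_add[OF assms] linear_scale[OF
      assms]
      scaleR_add_right sum.distrib scaleR_sum_right mult.commute)

lemma contr_tens_map:
  assumes "linear f"
  shows "contr x (tens_map U f v) = f (contr (transpose U *v x) v)"
proof -
  have "contr x (tens_map U f v) = (\<Sum>i\<in>UNIV. \<Sum>a\<in>UNIV. (x$i * U$i$a) *\<^sub>R f (v$a))"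
    by (simp add: contr_def tens_map_def scaleR_sum_right)
  also have "\<dots> = (\<Sum>a\<in>UNIV. \<Sum>i\<in>UNIV. (x$i * U$i$a) *\<^sub>R f (v$a))"
    by (rule sum.swap)
  also have "\<dots> = f (contr (transpose U *v x) v)"
    by (simp add: contr_def linear_sum[OF assms] linear_scale[OF assms] matrix_vector_mult_def
        transpose_def scaleR_sum_left mult.commute)
  finally show ?thesis .
qed

text \<open>In the expanded square, orthonormality of the columns of \<open>U\<close> leaves only
  the terms with a = b, for which it is enough that \<open>f\<close> preserves norms.\<close>

lemma norm_tens_map:
  fixes f :: "'b::real_inner \<Rightarrow> 'c::real_inner"
  assumes "orthogonal_matrix U" "\<And>x. norm (f x) = norm x"
  shows "norm (tens_map U f v) = norm v"
proof -
  have UU: "(\<Sum>i\<in>UNIV. U$i$a * U$i$b) = (if a = b then 1 else 0)" for a b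
  proof -
    have "(transpose U ** U)$a$b = (if a = b then 1 else 0)"
      using assms(1) by (simp add: orthogonal_matrix mat_def)
    then show ?thesis by (simp add: matrix_matrix_mult_def transpose_def)
  qed
  have "(norm (tens_map U f v))\<^sup>2 = 
     (\<Sum>i\<in>UNIV. \<Sum>a\<in>UNIV. \<Sum>b\<in>UNIV. (U$i$a * U$i$b) * (f (v$a) \<bullet> f (v$b)))"
    by (simp add: power2_norm_eq_inner inner_vec_def tens_map_def inner_sum_left inner_sum_right
        sum_distrib_left mult_ac inner_commute)
  also have "\<dots> = (\<Sum>a\<in>UNIV. \<Sum>i\<in>UNIV. \<Sum>b\<in>UNIV. (U$i$a * U$i$b) * (f (v$a) \<bullet> f (v$b)))"
    by (rule sum.swap)
  also have "\<dots> = (\<Sum>a\<in>UNIV. \<Sum>b\<in>UNIV. \<Sum>i\<in>UNIV. (U$i$a * U$i$b) * (f (v$a) \<bullet> f (v$b)))"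
    by (intro sum.cong refl sum.swap)
  also have "\<dots> = (\<Sum>a\<in>UNIV. f (v$a) \<bullet> f (v$a))"
    by (simp add: sum_distrib_right[symmetric] UU if_distrib[of "\<lambda>c. c * _"] cong: if_cong)
  also have "\<dots> = (\<Sum>a\<in>UNIV. v$a \<bullet> v$a)"
    using assms(2) by (simp flip: power2_norm_eq_inner)
  also have "\<dots> = (norm v)\<^sup>2"
    unfolding power2_norm_eq_inner inner_vec_def ..
  finally show ?thesis by simp
qed

text \<open>This is conjugation \<open>U ** S ** transpose U\<close>, as \<open>act2_matrix\<close>
  shows; the tensor form lets it share its proofs with \<open>act4\<close>.\<close>

definition act2 :: "real^'n^'n \<Rightarrow> real^'n^'n \<Rightarrow> real^'n^'n" where
  "act2 U = tens_map U (tens_map U (\<lambda>x. x))"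

definition act4 :: "real^'n^'n \<Rightarrow> real^'n^'n^'n^'n \<Rightarrow> real^'n^'n^'n^'n" where
  "act4 U = tens_map U (tens_map U (tens_map U (tens_map U (\<lambda>x. x))))"

definition form2 :: "real^'n^'n \<Rightarrow> real^'n \<Rightarrow> real^'n \<Rightarrow> real" where
  "form2 S x y = contr y (contr x S)"

definition form4 :: "real^'n^'n^'n^'n \<Rightarrow> real^'n \<Rightarrow> real^'n \<Rightarrow> real^'n \<Rightarrow> real^'n \<Rightarrow> real" where
  "form4 B x y z w = contr w (contr z (contr y (contr x B)))"

lemma linear_act2: "linear (act2 U)" and linear_act4: "linear (act4 U)"
  by (simp_all add: act2_def act4_def linear_tens_map linear_ident)

lemma norm_act2: "orthogonal_matrix U \<Longrightarrow> norm (act2 U S) = norm S"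
  by (simp add: act2_def norm_tens_map)

lemma norm_act4: "orthogonal_matrix U \<Longrightarrow> norm (act4 U B) = norm B"
  by (simp add: act4_def norm_tens_map)

lemma form2_act2: "form2 (act2 U S) x y = form2 S (transpose U *v x) (transpose U *v y)"
  by (simp add: form2_def act2_def contr_tens_map linear_tens_map linear_ident)

lemma form4_act4: "form4 (act4 U B) x y z w = 
    form4 B (transpose U *v x) (transpose U *v y) (transpose U *v z) (transpose U *v w)"
  by (simp add: form4_def act4_def contr_tens_map linear_tens_map linear_ident)

lemma contr_axis [simp]: "contr (axis i 1) v = v $ i"
  by (simp add: contr_def axis_def if_distrib[of "\<lambda>c. c *\<^sub>R _"] cong: if_cong)

lemma contr_add_left: "contr (x + y) v = contr x v + contr y v"
  and contr_diff_left: "contr (x - y) v = contr x v - contr y v"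
  and contr_add_right: "contr x (v + w) = contr x v + contr x w"
  and contr_diff_right: "contr x (v - w) = contr x v - contr x w"
  and contr_scaleR_right: "contr x (c *\<^sub>R v) = c *\<^sub>R contr x v"
  by (simp_all add: contr_def scaleR_add_left scaleR_diff_left scaleR_add_right
      scaleR_diff_right sum.distrib sum_subtractf scaleR_sum_right mult.commute)

lemma form2_axis [simp]: "form2 S (axis i 1) (axis j 1) = S$i$j"
  by (simp add: form2_def)

lemma form4_axis [simp]: "form4 B (axis i 1) (axis j 1) (axis k 1) (axis l 1) = B$i$j$k$l"
  by (simp add: form4_def)

lemma form2_sum: "form2 S x y = (\<Sum>j\<in>UNIV. \<Sum>i\<in>UNIV. S$i$j * x$i * y$j)"
  by (simp add: form2_def contr_def sum_distrib_left mult_ac)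

lemma form2_matrix: "form2 S x y = x \<bullet> (S *v y)"
  unfolding form2_sum
  by (subst sum.swap) (simp add: inner_vec_def matrix_vector_mult_def sum_distrib_left mult_ac)

lemma form4_hom_poly4: "form4 B x x x x = hom_poly4 (\<lambda>i j k l. B$i$j$k$l) x"
proof -
  have "form4 B x x x x = (\<Sum>l\<in>UNIV. \<Sum>k\<in>UNIV. \<Sum>j\<in>UNIV. \<Sum>i\<in>UNIV. 
       B$i$j$k$l * x$i * x$j * x$k * x$l)"
    by (simp add: form4_def contr_def sum_distrib_left mult_ac)
  also have "\<dots> = (\<Sum>k\<in>UNIV. \<Sum>j\<in>UNIV. \<Sum>i\<in>UNIV. \<Sum>l\<in>UNIV. 
       B$i$j$k$l * x$i * x$j * x$k * x$l)"
    by (rule trans[OF sum.swap], rule sum.cong[OF refl], rule trans[OF sum.swap], rule sum.cong[OF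
        refl],
        rule sum.swap)
  also have "\<dots> = (\<Sum>j\<in>UNIV. \<Sum>i\<in>UNIV. \<Sum>k\<in>UNIV. \<Sum>l\<in>UNIV. 
       B$i$j$k$l * x$i * x$j * x$k * x$l)"
    by (rule trans[OF sum.swap], rule sum.cong[OF refl], rule sum.swap)
  also have "\<dots> = hom_poly4 (\<lambda>i j k l. B$i$j$k$l) x"
    unfolding hom_poly4_def by (rule sum.swap)
  finally show ?thesis .
qed

lemma act2_matrix: "act2 U S = U ** S ** transpose U"
proof -
  have eq: "form2 (act2 U S) x y = form2 (U ** S ** transpose U) x y" for x y
    unfolding form2_act2 unfolding form2_matrix
    by (simp add: matrix_vector_mul_assoc matrix_mul_assoc dot_lmul_matrix
        flip: matrix_vector_mul_assoc)
  have "(act2 U S)$i$j = (U ** S ** transpose U)$i$j" for i j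
    using eq[of "axis i 1" "axis j 1"] by (simp only: form2_axis)
  then show ?thesis by (simp add: vec_eq_iff)
qed

text \<open>For symmetric \<open>S\<close> this is three times the symmetrization of S \<otimes> S:
  one summand for each pairing of the four indices. The factor 3 recurs below.\<close>

definition sym_square :: "real^'n^'n \<Rightarrow> real^'n^'n^'n^'n" where
  "sym_square S = (\<chi> i j k l. S$i$j * S$k$l + S$i$k * S$j$l + S$i$l * S$j$k)"

lemma form4_sym_square:
  "form4 (sym_square S) x y z w =
    form2 S x y * form2 S z w + form2 S x z * form2 S y w + form2 S x w * form2 S y z"
proof -
  have "form4 (\<chi> i j k l. S$i$j * S$k$l) x y z w = form2 S x y * form2 S z w"
  proof -
    have 1: "contr x (\<chi> i j k l. S$i$j * S$k$l) = (\<chi> j k l. contr x S $ j * S$k$l)"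
      by (simp add: contr_def vec_eq_iff sum_distrib_right sum_distrib_left mult_ac)
    have 2: "contr y (\<chi> j k l. contr x S $ j * S$k$l) = form2 S x y *\<^sub>R S"
      by (simp add: form2_def contr_def vec_eq_iff sum_distrib_right sum_distrib_left mult_ac)
    show ?thesis unfolding form4_def 1 2 by (simp add: contr_scaleR_right form2_def)
  qed
  moreover have "form4 (\<chi> i j k l. S$i$k * S$j$l) x y z w = form2 S x z * form2 S y w"
  proof -
    have 1: "contr x (\<chi> i j k l. S$i$k * S$j$l) = (\<chi> j k l. contr x S $ k * S$j$l)"
      by (simp add: contr_def vec_eq_iff sum_distrib_right sum_distrib_left mult_ac)
    have 2: "contr y (\<chi> j k l. contr x S $ k * S$j$l) = (\<chi> k l. contr x S $ k * contr y S $ l)"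
      by (simp add: contr_def vec_eq_iff sum_distrib_right sum_distrib_left mult_ac)
    have 3: "contr z (\<chi> k l. contr x S $ k * contr y S $ l) = form2 S x z *\<^sub>R contr y S"
      by (simp add: form2_def contr_def[of z] vec_eq_iff sum_distrib_right sum_distrib_left
          mult_ac)
    show ?thesis unfolding form4_def 1 2 3 by (simp add: contr_scaleR_right form2_def)
  qed
  moreover have "form4 (\<chi> i j k l. S$i$l * S$j$k) x y z w = form2 S x w * form2 S y z"
  proof -
    have 1: "contr x (\<chi> i j k l. S$i$l * S$j$k) = (\<chi> j k l. contr x S $ l * S$j$k)"
      by (simp add: contr_def vec_eq_iff sum_distrib_right sum_distrib_left mult_ac)
    have 2: "contr y (\<chi> j k l. contr x S $ l * S$j$k) = (\<chi> k l. contr x S $ l * contr y S $ k)"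
      by (simp add: contr_def vec_eq_iff sum_distrib_right sum_distrib_left mult_ac)
    have 3: "contr z (\<chi> k l. contr x S $ l * contr y S $ k) = form2 S y z *\<^sub>R contr x S"
      by (simp add: form2_def contr_def[of z] vec_eq_iff sum_distrib_right sum_distrib_left
          mult_ac)
    show ?thesis unfolding form4_def 1 2 3 by (simp add: contr_scaleR_right form2_def)
  qed
  moreover have "sym_square S = (\<chi> i j k l. S$i$j * S$k$l) + (\<chi> i j k l. S$i$k * S$j$l)
      + (\<chi> i j k l. S$i$l * S$j$k)"
    by (simp add: sym_square_def vec_eq_iff)
  ultimately show ?thesis
    by (simp add: form4_def contr_add_right)
qed

text \<open>As multilinear forms, both sides evaluate \<open>form2 S\<close> at vectors moved by
  \<open>transpose U\<close>. This makes the orbit of pairs in \<open>average_inequality\<close>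
  invariant.\<close>

lemma act4_sym_square: "act4 U (sym_square S) = sym_square (act2 U S)"
proof -
  have eq: "form4 (act4 U (sym_square S)) x y z w = form4 (sym_square (act2 U S)) x y z w"
      for x y z w
    by (simp add: form4_act4 form4_sym_square form2_act2)
  have "(act4 U (sym_square S))$i$j$k$l = (sym_square (act2 U S))$i$j$k$l" for i j k l
    using eq[of "axis i 1" "axis j 1" "axis k 1" "axis l 1"] by (simp only: form4_axis)
  then show ?thesis by (simp add: vec_eq_iff)
qed

section \<open>Total symmetry and polarization\<close>

lemma contr_contr_commute:
  assumes "\<And>i j. B$i$j = B$j$i"
  shows "contr y (contr x B) = contr x (contr y B)"
proof -
  have "contr y (contr x B) = (\<Sum>j\<in>UNIV. \<Sum>i\<in>UNIV. (x$i * y$j) *\<^sub>R B$i$j)"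
    by (simp add: contr_def scaleR_sum_right mult.commute)
  also have "\<dots> = (\<Sum>i\<in>UNIV. \<Sum>j\<in>UNIV. (x$i * y$j) *\<^sub>R B$j$i)"
    by (subst sum.swap) (simp add: assms)
  also have "\<dots> = contr x (contr y B)"
    by (simp add: contr_def scaleR_sum_right)
  finally show ?thesis .
qed

text \<open>The three adjacent transpositions generate all permutations of four indices.\<close>

definition symmetric4 :: "real^'n^'n^'n^'n \<Rightarrow> bool" where
  "symmetric4 B \<longleftrightarrow> (\<forall>i j k l. B$i$j$k$l = B$j$i$k$l \<and> B$i$j$k$l = B$i$k$j$l \<and> B$i$j$k$l =
      B$i$j$l$k)"

lemma form4_symmetric:
  assumes "symmetric4 B"
  shows "form4 B x y z w = form4 B y x z w" (is ?A)
    and "form4 B x y z w = form4 B x z y w" (is ?B)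
    and "form4 B x y z w = form4 B x y w z" (is ?C)
proof -
  have "contr y (contr x B) = contr x (contr y B)"
    using assms by (intro contr_contr_commute) (simp add: symmetric4_def vec_eq_iff)
  then show ?A by (simp add: form4_def)
  have "contr z (contr y (contr x B)) = contr y (contr z (contr x B))"
    using assms by (intro contr_contr_commute) (simp add: symmetric4_def vec_eq_iff contr_def)
  then show ?B by (simp add: form4_def)
  have "contr w (contr z (contr y (contr x B))) = contr z (contr w (contr y (contr x B)))"
    using assms by (intro contr_contr_commute) (simp add: symmetric4_def contr_def)
  then show ?C by (simp add: form4_def)
qed

lemma form4_add:
  "form4 B (x + x') y z w = form4 B x y z w + form4 B x' y z w"
  "form4 B x (y + y') z w = form4 B x y z w + form4 B x y' z w"
  "form4 B x y (z + z') w = form4 B x y z w + form4 B x y z' w"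
  "form4 B x y z (w + w') = form4 B x y z w + form4 B x y z w'"
  by (simp_all add: form4_def contr_add_left contr_add_right)

lemma form4_diff:
  "form4 B (x - x') y z w = form4 B x y z w - form4 B x' y z w"
  "form4 B x (y - y') z w = form4 B x y z w - form4 B x y' z w"
  "form4 B x y (z - z') w = form4 B x y z w - form4 B x y z' w"
  "form4 B x y z (w - w') = form4 B x y z w - form4 B x y z w'"
  by (simp_all add: form4_def contr_diff_left contr_diff_right)

text \<open>Polarization: adding the values at x + y and x - y isolates the arguments x, x, y, y,
  and polarizing each of the two pairs separately then reaches four independent arguments.\<close>

lemma symmetric4_eq_0:
  assumes "symmetric4 B" and zero: "\<And>x. form4 B x x x x = 0"
  shows "B = 0"
proof -
  note sym = form4_symmetric[OF assms(1)]
  have 1: "form4 B x x y y = 0" for x y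
  proof -
    \<comment> \<open>Odd terms cancel; the six placements of two \<open>x\<close> and two
      \<open>y\<close> occur in both summands, hence the 12.\<close>
    have "form4 B (x + y) (x + y) (x + y) (x + y) + form4 B (x - y) (x - y) (x - y) (x - y)
        = 2 * form4 B x x x x + 2 * form4 B y y y y + 12 * form4 B x x y y"
      by (simp add: form4_add form4_diff sym)
    then show ?thesis by (simp add: zero)
  qed
  have 2: "form4 B x z y y = 0" for x y z
    using 1[of "x + z" y] 1[of x y] 1[of z y] sym(1)[of z x y y] by (simp add: form4_add)
  have 3: "form4 B x z y w = 0" for x y z w
    using 2[of x z "y + w"] 2[of x z y] 2[of x z w] sym(3)[of x z w y] by (simp add: form4_add)
  have "B$i$j$k$l = 0" for i j k l
    using 3[of "axis i 1" "axis j 1" "axis k 1" "axis l 1"] by simp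
  then show ?thesis by (simp add: vec_eq_iff)
qed

lemma symmetric4_sym_square:
  assumes "\<And>i j. S$i$j = S$j$i"
  shows "symmetric4 (sym_square S)"
  unfolding symmetric4_def sym_square_def by (simp add: assms mult_ac add_ac)

text \<open>A pairing is determined by the partner of \<open>i\<close>, so permuting j, k, l carries
  the first pairing to the other two. Relabelling the sums moves this permutation onto
  \<open>Q\<close>, which is invariant under it.\<close>

lemma sum_sym_square:
  fixes Q :: "'n::finite \<Rightarrow> 'n \<Rightarrow> 'n \<Rightarrow> 'n \<Rightarrow> real"
  assumes Q: "\<And>i j k l. Q i j k l = Q i k j l" "\<And>i j k l. Q i j k l = Q i j l k"
  shows "(\<Sum>i\<in>UNIV. \<Sum>j\<in>UNIV. \<Sum>k\<in>UNIV. \<Sum>l\<in>UNIV. sym_square S$i$j$k$l * Q i j k l) =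
     3 * (\<Sum>i\<in>UNIV. \<Sum>j\<in>UNIV. \<Sum>k\<in>UNIV. \<Sum>l\<in>UNIV. S$i$j * S$k$l * Q i j k l)"
proof -
  let ?q = "\<lambda>i j k l. S$i$j * S$k$l * Q i j k l"
  let ?s = "\<lambda>f. \<Sum>i\<in>UNIV. \<Sum>j\<in>UNIV. \<Sum>k\<in>UNIV. \<Sum>l\<in>UNIV. f i j k l :: real"
  have "?s (\<lambda>i j k l. S$i$k * S$j$l * Q i j k l) = ?s (\<lambda>i j k l. ?q i k j l)"
    by (simp add: Q(1))
  also have "\<dots> = ?s ?q"
    by (rule sum.cong[OF refl], rule sum.swap)
  finally have 2: "?s (\<lambda>i j k l. S$i$k * S$j$l * Q i j k l) = ?s ?q" .
  have "Q i j k l = Q i l j k" for i j k l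
    by (metis Q)
  then have "?s (\<lambda>i j k l. S$i$l * S$j$k * Q i j k l) = ?s (\<lambda>i j k l. ?q i l j k)"
    by simp
  also have "\<dots> = (\<Sum>i\<in>UNIV. \<Sum>j\<in>UNIV. \<Sum>l\<in>UNIV. \<Sum>k\<in>UNIV. ?q i l j k)"
    by (rule sum.cong[OF refl], rule sum.cong[OF refl], rule sum.swap)
  also have "\<dots> = ?s ?q"
    by (rule sum.cong[OF refl], rule sum.swap)
  finally have 3: "?s (\<lambda>i j k l. S$i$l * S$j$k * Q i j k l) = ?s ?q" .
  have "?s (\<lambda>i j k l. sym_square S$i$j$k$l * Q i j k l) = ?s ?q
      + ?s (\<lambda>i j k l. S$i$k * S$j$l * Q i j k l) + ?s (\<lambda>i j k l. S$i$l * S$j$k * Q i j k l)"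
    by (simp add: sym_square_def ring_distribs sum.distrib)
  then show ?thesis by (simp add: 2 3)
qed

lemma hom_poly4_form2_times_norm:
  "hom_poly4 (\<lambda>i j k l. S$i$j * (if k = l then 1 else 0)) x = form2 S x x * (x \<bullet> x)"
proof -
  have "hom_poly4 (\<lambda>i j k l. S$i$j * (if k = l then 1 else 0)) x =
     (\<Sum>i\<in>UNIV. \<Sum>j\<in>UNIV. \<Sum>k\<in>UNIV. (S$i$j * x$i * x$j) * (x$k * x$k))"
    by (simp add: hom_poly4_def if_distrib[of "\<lambda>c. c * _"] if_distrib[of "\<lambda>c. _ * c"] mult_ac
        cong: if_cong)
  also have "\<dots> = (\<Sum>i\<in>UNIV. \<Sum>j\<in>UNIV. S$i$j * x$i * x$j) * (x \<bullet> x)"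
    by (simp add: inner_vec_def sum_distrib_left[symmetric] sum_distrib_right[symmetric])
  also have "(\<Sum>i\<in>UNIV. \<Sum>j\<in>UNIV. S$i$j * x$i * x$j) = form2 S x x"
    unfolding form2_sum by (rule sum.swap)
  finally show ?thesis .
qed

lemma norm_pow4: "norm (x::'a::real_inner) ^ 4 = (x \<bullet> x)\<^sup>2"
  by (simp add: power2_norm_eq_inner[symmetric])

lemma scaled_identity_of_form2:
  assumes sym: "\<And>i j. S$i$j = S$j$i" and quad: "\<And>x. form2 S x x = a * (x \<bullet> x)"
  shows "S = a *\<^sub>R mat 1"
proof -
  have diag: "S$i$i = a" for i
    using quad[of "axis i 1"] by (simp add: inner_axis_axis)
  have "S$i$j = 0" if "i \<noteq> j" for i j
  proof -
    have "form2 S (axis i 1 + axis j 1) (axis i 1 + axis j 1) = S$i$i + S$i$j + S$j$i + S$j$j"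
      by (simp add: form2_def contr_add_left contr_add_right)
    then show ?thesis
      using quad[of "axis i 1 + axis j 1"] that sym[of j i]
      by (simp add: inner_axis_axis inner_add_left inner_add_right diag)
  qed
  then show ?thesis using diag by (auto simp: vec_eq_iff mat_def)
qed

lemma form2_mat_1 [simp]: "form2 (mat 1) x y = x \<bullet> y"
  by (simp add: form2_matrix)

lemma act2_mult: "act2 V (act2 U S) = act2 (V ** U) S"
  by (simp add: act2_matrix matrix_mul_assoc matrix_transpose_mul)

lemma trace_act2:
  assumes "orthogonal_matrix U"
  shows "trace (act2 U S) = trace S" "trace (act2 U S ** act2 U S) = trace (S ** S)"
proof -
  have U: "transpose U ** U = mat 1"
    using assms by (simp add: orthogonal_matrix)
  have *: "trace (act2 U A) = trace A" for A
  proof -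
    have "trace (act2 U A) = trace (transpose U ** (U ** A))"
      unfolding act2_matrix by (rule trace_mul_sym)
    then show ?thesis by (simp add: matrix_mul_assoc U)
  qed
  show "trace (act2 U S) = trace S" by (rule *)
  have "act2 U S ** act2 U S = U ** S ** (transpose U ** U) ** S ** transpose U"
    by (simp add: act2_matrix matrix_mul_assoc)
  then have "act2 U S ** act2 U S = act2 U (S ** S)"
    by (simp add: U act2_matrix matrix_mul_assoc)
  then show "trace (act2 U S ** act2 U S) = trace (S ** S)" by (simp add: *)
qed

lemma transpose_act2: "transpose S = S \<Longrightarrow> transpose (act2 U S) = act2 U S"
  by (simp add: act2_matrix matrix_transpose_mul matrix_mul_assoc)

lemma trace_square_symmetric:
  fixes S :: "real^'n^'n"
  assumes "\<And>i j. S$i$j = S$j$i"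
  shows "trace (S ** S) = (\<Sum>i\<in>UNIV. \<Sum>j\<in>UNIV. S$i$j * S$i$j)"
proof -
  have "S$i$j * S$j$i = S$i$j * S$i$j" for i j
    using assms[of i j] by simp
  then show ?thesis by (simp only: trace_def matrix_matrix_mult_def vec_lambda_beta)
qed

text \<open>One of the three pairings gives the product of two traces, the other two the sum of the
  squared entries. This is the source of the numerator in the theorem.\<close>

lemma trace_sym_square:
  assumes "\<And>i j. S$i$j = S$j$i"
  shows "(\<Sum>i\<in>UNIV. \<Sum>j\<in>UNIV. sym_square S$i$i$j$j) = (trace S)\<^sup>2 + 2 * trace (S ** S)"
proof -
  have "(trace S)\<^sup>2 = (\<Sum>i\<in>UNIV. \<Sum>j\<in>UNIV. S$i$i * S$j$j)"
    by (simp add: trace_def power2_eq_square sum_product)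
  then show ?thesis
    unfolding trace_square_symmetric[OF assms]
    by (simp add: sym_square_def sum.distrib sum_distrib_left)
qed

section \<open>Averages over a group whose invariant quartics are multiples of |x|^4\<close>

locale frame_group =
  fixes G :: "(real^'n^'n) set"
  assumes orth: "U \<in> G \<Longrightarrow> orthogonal_matrix U"
    and one: "mat 1 \<in> G"
    and mult: "U \<in> G \<Longrightarrow> V \<in> G \<Longrightarrow> U ** V \<in> G"
    and transp: "U \<in> G \<Longrightarrow> transpose U \<in> G"
    and frame: "\<lbrakk>\<And>U x. U \<in> G \<Longrightarrow> hom_poly4 c (U *v x) = hom_poly4 c x\<rbrakk>
       \<Longrightarrow> \<exists>a. \<forall>x. hom_poly4 c x = a * norm x ^ 4"
begin

text \<open>The frame property is about degree 4 alone, so the quadratic form is multiplied by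
  |x|^2, recognized as a |x|^4, and divided by |x|^2 again.\<close>

lemma invariant_tensor2:
  assumes sym: "\<And>i j. A$i$j = A$j$i" and inv: "\<And>U. U \<in> G \<Longrightarrow> act2 U A = A"
  obtains a where "A = a *\<^sub>R mat 1"
proof -
  let ?c = "\<lambda>i j k l. A$i$j * (if k = l then 1 else 0)"
  have "hom_poly4 ?c (U *v x) = hom_poly4 ?c x" if U: "U \<in> G" for U x
  proof -
    have "form2 A (U *v x) (U *v x) = form2 A x x"
      using form2_act2[of "transpose U" A x x] inv[OF transp[OF U]] by simp
    moreover have "(U *v x) \<bullet> (U *v x) = x \<bullet> x"
      using form2_act2[of "transpose U" "mat 1" x x] orth[OF U]
      by (simp add: act2_matrix orthogonal_matrix)
    ultimately show ?thesis by (simp only: hom_poly4_form2_times_norm)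
  qed
  then obtain a where a: "hom_poly4 ?c x = a * norm x ^ 4" for x
    using frame[of ?c] by blast
  have "form2 A x x = a * (x \<bullet> x)" for x
  proof (cases "x = 0")
    case True
    then show ?thesis by (simp add: form2_matrix)
  next
    case False
    then show ?thesis
      using a[of x] by (simp add: hom_poly4_form2_times_norm norm_pow4 power2_eq_square)
  qed
  then show ?thesis using scaled_identity_of_form2[of A a] sym that by blast
qed

lemma invariant_tensor4:
  assumes sym: "symmetric4 B" and inv: "\<And>U. U \<in> G \<Longrightarrow> act4 U B = B"
  obtains b where "B = b *\<^sub>R sym_square (mat 1)"
proof -
  let ?c = "\<lambda>i j k l. B$i$j$k$l"
  have "hom_poly4 ?c (U *v x) = hom_poly4 ?c x" if U: "U \<in> G" for U x
    using form4_act4[of "transpose U" B x x x x] inv[OF transp[OF U]]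
    by (simp flip: form4_hom_poly4)
  then obtain b where b: "hom_poly4 ?c x = b * norm x ^ 4" for x
    using frame[of ?c] by blast
  have id: "symmetric4 (sym_square (mat 1))"
    by (intro symmetric4_sym_square) (simp add: mat_def)
  \<comment> \<open>On the diagonal \<open>sym_square (mat 1)\<close> takes the value 3 |x|^4, so
    the factor b/3 makes the two quartics agree; polarization then identifies the tensors.\<close>
  have "B - (b/3) *\<^sub>R sym_square (mat 1) = 0"
  proof (rule symmetric4_eq_0)
    show "symmetric4 (B - (b/3) *\<^sub>R sym_square (mat 1))"
      using sym id unfolding symmetric4_def by simp blast
    have "form4 (B - (b/3) *\<^sub>R sym_square (mat 1)) x x x x
        = form4 B x x x x - b/3 * form4 (sym_square (mat 1)) x x x x" for x
      by (simp add: form4_def contr_diff_right contr_scaleR_right)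
    then show "form4 (B - (b/3) *\<^sub>R sym_square (mat 1)) x x x x = 0" for x
      using b[of x] by (simp add: form4_sym_square norm_pow4 power2_eq_square flip:
          form4_hom_poly4)
  qed
  then show ?thesis using that[of "b/3"] by simp
qed

text \<open>In the application \<open>L\<close> is the eigenvalue of the image domain, and
  \<open>P\<close> and \<open>Q\<close> hold the integrals of u_i u_j and u_ij u_kl. The conclusion
  is the hypothesis with \<open>R\<close> and the symmetrization of R \<otimes> R replaced by their
  average values.\<close>

lemma average_inequality:
  fixes P :: "'n \<Rightarrow> 'n \<Rightarrow> real" and Q :: "'n \<Rightarrow> 'n \<Rightarrow> 'n \<Rightarrow> 'n \<Rightarrow> real"
  assumes S: "transpose S = S"
    and Q: "\<And>i j k l. Q i j k l = Q i k j l" "\<And>i j k l. Q i j k l = Q i j l k"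
    and le: "\<And>U R. U \<in> G \<Longrightarrow> R = U ** S ** transpose U \<Longrightarrow>
       L * (\<Sum>i\<in>UNIV. \<Sum>j\<in>UNIV. R$i$j * P i j) \<le>
       (\<Sum>i\<in>UNIV. \<Sum>j\<in>UNIV. \<Sum>k\<in>UNIV. \<Sum>l\<in>UNIV. R$i$j * R$k$l * Q i j k l)"
  shows "L * (trace S / real CARD('n)) * (\<Sum>i\<in>UNIV. P i i) \<le> 
     ((trace S)\<^sup>2 + 2 * trace (S ** S)) / (real CARD('n) * (real CARD('n) + 2)) * 
     (\<Sum>i\<in>UNIV. \<Sum>j\<in>UNIV. Q i i j j)"
proof -
  define f where "f = (\<lambda>U (p :: (real^'n^'n) \<times> (real^'n^'n^'n^'n)). (act2 U (fst p), act4 U (snd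
      p)))"
  define C where "C = (\<lambda>U. (act2 U S, sym_square (act2 U S))) ` G"
  obtain p where p: "p \<in> closure (convex hull C)" and fix_p: "\<And>U. U \<in> G \<Longrightarrow> f U p = p"
  proof (rule invariant_point_of_hull[of C "f ` G"])
    show "C \<noteq> {}" using one by (auto simp: C_def)
    show "linear h" if h: "h \<in> f ` G" for h
    proof -
      obtain U where "h = f U" using h by auto
      then show ?thesis unfolding f_def
        by (intro linearI) (auto simp: linear_add[OF linear_act2] linear_add[OF linear_act4]
            linear_scale[OF linear_act2] linear_scale[OF linear_act4])
    qed
    show "norm (h x) = norm x" if h: "h \<in> f ` G" for h x
    proof -
      obtain U where "h = f U" "U \<in> G" using h by auto
      then show ?thesis by (simp add: f_def norm_prod_def norm_act2 norm_act4 orth)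
    qed
    show "h ` C \<subseteq> C" if h: "h \<in> f ` G" for h
    proof -
      obtain U where "h = f U" "U \<in> G" using h by auto
      then show ?thesis using mult by (auto simp: f_def C_def act4_sym_square act2_mult)
    qed
  qed auto
  obtain A B where AB: "p = (A, B)" by fastforce
  have C: "\<exists>U\<in>G. c = (R, sym_square R) \<and> R = act2 U S \<and> (\<forall>i j. R$i$j = R$j$i)"
      if c: "c \<in> C" "R = fst c" for c R
  proof -
    obtain U where U: "U \<in> G" "c = (act2 U S, sym_square (act2 U S))"
      using c by (auto simp: C_def)
    moreover have "R$i$j = R$j$i" for i j
      using transpose_act2[OF S, of U] U c by (metis fst_conv transpose_def vec_lambda_beta)
    ultimately show ?thesis using c by auto
  qed
  note hull = linear_eq_on_closed_hull[OF _ _ p]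

  \<comment> \<open>Symmetry and traces are linear conditions, so they hold at \<open>p\<close> as
    on the orbit.\<close>
  have sym2: "A$i$j = A$j$i" for i j
  proof -
    have "(\<lambda>c. fst c$i$j - fst c$j$i) p = 0"
      by (rule hull, rule linearI) (use C in \<open>auto simp: algebra_simps\<close>)
    then show ?thesis by (simp add: AB)
  qed
  have sym4: "symmetric4 B"
  proof -
    have s: "symmetric4 (snd c)" if c: "c \<in> C" for c
      using C[OF c refl] symmetric4_sym_square[of "fst c"] by (metis snd_conv)
    have "(\<lambda>c. snd c$i$j$k$l - snd c$j$i$k$l) p = 0" for i j k l
      by (rule hull, rule linearI)
        (use s in \<open>simp_all add: algebra_simps symmetric4_def\<close>)
    moreover have "(\<lambda>c. snd c$i$j$k$l - snd c$i$k$j$l) p = 0" for i j k l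
      by (rule hull, rule linearI)
        (use s in \<open>simp_all add: algebra_simps symmetric4_def\<close>)
    moreover have "(\<lambda>c. snd c$i$j$k$l - snd c$i$j$l$k) p = 0" for i j k l
      by (rule hull, rule linearI)
        (use s in \<open>simp_all add: algebra_simps symmetric4_def\<close>)
    ultimately show ?thesis by (simp add: AB symmetric4_def)
  qed
  have tr2: "trace A = trace S"
  proof -
    have "(\<lambda>c. trace (fst c)) p = trace S"
      by (rule hull, rule linearI)
        (use C orth in \<open>force simp: trace_def sum.distrib sum_distrib_left trace_act2[unfolded
            trace_def]\<close>)+
    then show ?thesis by (simp add: AB)
  qed
  have tr4: "(\<Sum>i\<in>UNIV. \<Sum>j\<in>UNIV. B$i$i$j$j) = (trace S)\<^sup>2 + 2 * trace (S ** S)"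
  proof -
    have "(\<lambda>c. \<Sum>i\<in>UNIV. \<Sum>j\<in>UNIV. snd c$i$i$j$j) p = (trace S)\<^sup>2 + 2 * trace (S ** S)"
    proof (rule hull, rule linearI)
      show "(\<Sum>i\<in>UNIV. \<Sum>j\<in>UNIV. snd c$i$i$j$j) = (trace S)\<^sup>2 + 2 * trace (S ** S)"
        if c: "c \<in> C" for c
      proof -
        obtain U R where R: "U \<in> G" "c = (R, sym_square R)" "R = act2 U S" "\<forall>i j. R$i$j = R$j$i"
          using C[OF c refl] by blast
        then show ?thesis
          using trace_sym_square[of R] trace_act2[OF orth[OF R(1)], of S] by simp
      qed
    qed (simp_all add: sum.distrib sum_distrib_left)
    then show ?thesis by (simp add: AB)
  qed
  \<comment> \<open>The hypothesis becomes linear in the pair; dividing by 3 undoes the factor from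
    \<open>sum_sym_square\<close>.\<close>
  have "(\<lambda>c. L * (\<Sum>i\<in>UNIV. \<Sum>j\<in>UNIV. fst c$i$j * P i j) - 
     (\<Sum>i\<in>UNIV. \<Sum>j\<in>UNIV. \<Sum>k\<in>UNIV. \<Sum>l\<in>UNIV. snd c$i$j$k$l * Q i j k l) / 3) p \<le> 0"
  proof (rule linear_le_on_closed_hull[OF _ _ p], rule linearI)
    show "L * (\<Sum>i\<in>UNIV. \<Sum>j\<in>UNIV. fst c$i$j * P i j) - 
     (\<Sum>i\<in>UNIV. \<Sum>j\<in>UNIV. \<Sum>k\<in>UNIV. \<Sum>l\<in>UNIV. snd c$i$j$k$l * Q i j k l) / 3 \<le> 0"
      if c: "c \<in> C" for c
    proof -
      obtain U R where R: "U \<in> G" "c = (R, sym_square R)" "R = act2 U S" 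
        using C[OF c refl] by blast
      then show ?thesis
        using le[OF R(1), of R] sum_sym_square[of Q R, OF Q] by (simp add: act2_matrix)
    qed
  qed (simp_all add: sum.distrib sum_distrib_left algebra_simps add_divide_distrib
      sum_divide_distrib)
  then have main: "3 * (L * (\<Sum>i\<in>UNIV. \<Sum>j\<in>UNIV. A$i$j * P i j)) \<le>
     (\<Sum>i\<in>UNIV. \<Sum>j\<in>UNIV. \<Sum>k\<in>UNIV. \<Sum>l\<in>UNIV. B$i$j$k$l * Q i j k l)"
    by (simp add: AB)

  obtain a where a: "A = a *\<^sub>R mat 1"
    using invariant_tensor2[of A] fix_p sym2 by (auto simp: AB f_def)
  obtain b where b: "B = b *\<^sub>R sym_square (mat 1)"
    using invariant_tensor4[of B] fix_p sym4 by (auto simp: AB f_def)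
  have a': "a = trace S / real CARD('n)"
    using tr2 by (simp add: a trace_def mat_def field_simps)
  have "(\<Sum>i\<in>UNIV. \<Sum>j\<in>UNIV. B$i$i$j$j) = 
     b * (\<Sum>i\<in>UNIV. \<Sum>j\<in>UNIV. sym_square (mat 1 :: real^'n^'n)$i$i$j$j)"
    by (simp add: b sum_distrib_left)
  \<comment> \<open>For the identity in dimension d the contraction is d^2 + 2 d, so comparison with
    \<open>tr4\<close> determines \<open>b\<close>.\<close>
  also have "(\<Sum>i\<in>UNIV. \<Sum>j\<in>UNIV. sym_square (mat 1 :: real^'n^'n)$i$i$j$j) =
      real CARD('n) * (real CARD('n) + 2)"
    by (subst trace_sym_square, simp add: mat_def) (simp add: trace_I power2_eq_square
        algebra_simps)
  finally have b': "b = ((trace S)\<^sup>2 + 2 * trace (S ** S)) / (real CARD('n) * (real CARD('n) +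
      2))"
    using tr4 nonzero_eq_divide_eq[of "real CARD('n) * (real CARD('n) + 2)" b] by simp
  have "(\<Sum>i\<in>UNIV. \<Sum>j\<in>UNIV. A$i$j * P i j) = a * (\<Sum>i\<in>UNIV. P i i)"
    by (simp add: a mat_def sum_distrib_left if_distrib[of "\<lambda>c. c * _"] if_distrib[of "\<lambda>c. _ * c"]
        cong: if_cong)
  moreover have "(\<Sum>i\<in>UNIV. \<Sum>j\<in>UNIV. \<Sum>k\<in>UNIV. \<Sum>l\<in>UNIV. B$i$j$k$l * Q i j k l) =
      b * (\<Sum>i\<in>UNIV. \<Sum>j\<in>UNIV. \<Sum>k\<in>UNIV. \<Sum>l\<in>UNIV. sym_square (mat 1)$i$j$k$l * Q i j k l)"
    by (simp add: b sum_distrib_left mult.assoc)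
  moreover have "(\<Sum>i\<in>UNIV. \<Sum>j\<in>UNIV. \<Sum>k\<in>UNIV. \<Sum>l\<in>UNIV. sym_square (mat 1)$i$j$k$l * Q i j k l)
     = 3 * (\<Sum>i\<in>UNIV. \<Sum>k\<in>UNIV. Q i i k k)"
  proof -
    have "(\<Sum>k\<in>UNIV. \<Sum>l\<in>UNIV. (mat 1 :: real^'n^'n)$i$j * (mat 1 :: real^'n^'n)$k$l * Q i j k l) =
        (if i = j then \<Sum>k\<in>UNIV. Q i i k k else 0)" for i j
      by (simp add: mat_def if_distrib[of "\<lambda>c. c * _"] cong: if_cong)
    then show ?thesis
      by (simp add: sum_sym_square[of Q, OF Q])
  qed
  ultimately show ?thesis
    using main unfolding a'[symmetric] b'[symmetric] by (simp add: mult_ac)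
qed

end

section \<open>Integral identities\<close>

lemma nn_integral_lborel_translate:
  fixes f :: "'a::euclidean_space \<Rightarrow> ennreal"
  assumes [measurable]: "f \<in> borel_measurable borel"
  shows "(\<integral>\<^sup>+x. f (c + x) \<partial>lborel) = (\<integral>\<^sup>+x. f x \<partial>lborel)"
proof -
  have "(\<integral>\<^sup>+x. f x \<partial>lborel) = (\<integral>\<^sup>+x. f x \<partial>(distr lborel borel ((+) c)))"
    by (simp only: lborel_distr_plus)
  also have "\<dots> = (\<integral>\<^sup>+x. f (c + x) \<partial>lborel)"
    by (subst nn_integral_distr) auto
  finally show ?thesis by simp
qed

lemma nn_integral_lborel_reflect:
  fixes f :: "'a::euclidean_space \<Rightarrow> ennreal"
  assumes [measurable]: "f \<in> borel_measurable borel"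
  shows "(\<integral>\<^sup>+x. f (- x) \<partial>lborel) = (\<integral>\<^sup>+x. f x \<partial>lborel)"
proof -
  have "(\<integral>\<^sup>+x. f x \<partial>lborel) = (\<integral>\<^sup>+x. f x \<partial>(distr lborel borel (\<lambda>x::'a. 0 + (- 1) *\<^sub>R x)))"
    using lborel_affine[of "-1" "0::'a"] by (simp add: density_1)
  also have "\<dots> = (\<integral>\<^sup>+x. f (- x) \<partial>lborel)"
    by (subst nn_integral_distr) auto
  finally show ?thesis by simp
qed

text \<open>Says that \<open>N\<close> scales all integrals by the same factor. Multiplying two integrals and
    shifting
  one variable by a linear image of the other avoids determinants (the library formula needs a
  well-ordered index type).\<close>

lemma nn_integral_linear_exchange:
  fixes f g :: "'a::euclidean_space \<Rightarrow> ennreal" and N N' :: "'a \<Rightarrow> 'a"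
  assumes [measurable]: "f \<in> borel_measurable borel" "g \<in> borel_measurable borel"
    and N: "linear N" and inv: "\<And>x. N (N' x) = x"
  shows "(\<integral>\<^sup>+x. f x \<partial>lborel) * (\<integral>\<^sup>+y. g (N y) \<partial>lborel) =
         (\<integral>\<^sup>+y. f (N y) \<partial>lborel) * (\<integral>\<^sup>+x. g x \<partial>lborel)"
proof -
  have [measurable]: "N \<in> borel_measurable borel"
    using N by (intro borel_measurable_continuous_onI linear_continuous_on) (simp add:
        linear_conv_bounded_linear)
  have "(\<integral>\<^sup>+x. f x \<partial>lborel) * (\<integral>\<^sup>+y. g (N y) \<partial>lborel) =
      (\<integral>\<^sup>+y. (\<integral>\<^sup>+x. f x * g (N y) \<partial>lborel) \<partial>lborel)"
    by (simp add: nn_integral_multc nn_integral_cmult)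
  also have "\<dots> = (\<integral>\<^sup>+y. (\<integral>\<^sup>+x. f (N y + x) * g (N y) \<partial>lborel) \<partial>lborel)"
    by (intro nn_integral_cong nn_integral_lborel_translate[symmetric, of "\<lambda>x. f x * g (N _)"])
        measurable
  also have "\<dots> = (\<integral>\<^sup>+x. (\<integral>\<^sup>+y. f (N y + x) * g (N y) \<partial>lborel) \<partial>lborel)"
    by (rule lborel_pair.Fubini') measurable
  also have "\<dots> = (\<integral>\<^sup>+x. (\<integral>\<^sup>+y. f (N y) * g (N y - x) \<partial>lborel) \<partial>lborel)"
  proof (rule nn_integral_cong)
    fix x
    show "(\<integral>\<^sup>+y. f (N y + x) * g (N y) \<partial>lborel) = (\<integral>\<^sup>+y. f (N y) * g (N y - x) \<partial>lborel)"
      \<comment> \<open>Shifting \<open>y\<close> by \<open>- N' x\<close> replaces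
        \<open>N y + x\<close> by \<open>N y\<close>, because \<open>N (N' x) = x\<close>.\<close>
      by (subst nn_integral_lborel_translate[symmetric, of _ "- N' x"])
         (auto simp: linear_add[OF N] linear_diff[OF N] linear_neg[OF N] inv algebra_simps)
  qed
  also have "\<dots> = (\<integral>\<^sup>+y. (\<integral>\<^sup>+x. f (N y) * g (N y - x) \<partial>lborel) \<partial>lborel)"
    by (rule lborel_pair.Fubini') measurable
  also have "\<dots> = (\<integral>\<^sup>+y. f (N y) * (\<integral>\<^sup>+x. g x \<partial>lborel) \<partial>lborel)"
  proof (rule nn_integral_cong)
    fix y
    have "(\<integral>\<^sup>+x. g (N y - x) \<partial>lborel) = (\<integral>\<^sup>+x. g (N y + x) \<partial>lborel)"
      using nn_integral_lborel_reflect[of "\<lambda>x. g (N y + x)"] by simp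
    then show "(\<integral>\<^sup>+x. f (N y) * g (N y - x) \<partial>lborel) = f (N y) * (\<integral>\<^sup>+x. g x \<partial>lborel)"
      by (simp add: nn_integral_cmult nn_integral_lborel_translate)
  qed
  also have "\<dots> = (\<integral>\<^sup>+y. f (N y) \<partial>lborel) * (\<integral>\<^sup>+x. g x \<partial>lborel)"
    by (simp add: nn_integral_multc)
  finally show ?thesis .
qed

section \<open>Continuous functions of bounded support\<close>

definition cont_bsupp :: "('a::euclidean_space \<Rightarrow> 'b::real_normed_vector) \<Rightarrow> bool" where
  "cont_bsupp f \<longleftrightarrow> continuous_on UNIV f \<and> bounded {x. f x \<noteq> 0}"

lemma cont_bsuppE:
  assumes "cont_bsupp f"
  obtains r where "\<And>x. norm x > r \<Longrightarrow> f x = 0"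
  using assms unfolding cont_bsupp_def bounded_iff by (metis linorder_not_le mem_Collect_eq)

lemma cont_bsupp_mult:
  fixes f g :: "'a::euclidean_space \<Rightarrow> real"
  assumes "cont_bsupp f" "continuous_on UNIV g"
  shows "cont_bsupp (\<lambda>x. f x * g x)" "cont_bsupp (\<lambda>x. g x * f x)"
proof -
  have "bounded {x. f x * g x \<noteq> 0}"
    by (rule bounded_subset[of "{x. f x \<noteq> 0}"]) (use assms in \<open>auto simp: cont_bsupp_def\<close>)
  then show "cont_bsupp (\<lambda>x. f x * g x)" "cont_bsupp (\<lambda>x. g x * f x)"
    using assms by (auto simp: cont_bsupp_def mult.commute intro!: continuous_intros)
qed

lemma cont_bsupp_translate:
  assumes "cont_bsupp f"
  shows "cont_bsupp (\<lambda>x. f (x + a))"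
proof -
  have "{x. f (x + a) \<noteq> 0} \<subseteq> (\<lambda>x. x - a) ` {x. f x \<noteq> 0}"
    by (auto intro!: image_eqI[of _ _ "_ + a"])
  moreover have "bounded ((\<lambda>x. x - a) ` {x. f x \<noteq> 0})"
    using assms by (auto simp: cont_bsupp_def bounded_translation_minus)
  moreover have "continuous_on UNIV (\<lambda>x. f (x + a))"
    using assms by (auto simp: cont_bsupp_def intro!: continuous_on_compose2[of UNIV f]
        continuous_intros)
  ultimately show ?thesis
    by (auto simp: cont_bsupp_def intro: bounded_subset)
qed

lemma cont_bsupp_integrable:
  fixes f :: "'a::euclidean_space \<Rightarrow> real"
  assumes "cont_bsupp f"
  shows "integrable lborel f"
proof -
  obtain r where r: "\<And>x. norm x > r \<Longrightarrow> f x = 0"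
    using assms by (rule cont_bsuppE) blast
  have "integrable lborel (\<lambda>x. indicator (cball 0 r) x *\<^sub>R f x)"
    by (rule borel_integrable_compact)
       (use assms in \<open>auto simp: cont_bsupp_def intro: continuous_on_subset\<close>)
  moreover have "(\<lambda>x. indicator (cball 0 r) x *\<^sub>R f x) = f"
    using r by (auto simp: fun_eq_iff indicator_def not_le)
  ultimately show ?thesis by simp
qed

lemma cont_bsupp_bounded:
  assumes "cont_bsupp f"
  obtains B where "\<And>x. norm (f x) \<le> B" "B \<ge> 0"
proof -
  obtain r where r: "\<And>x. norm x > r \<Longrightarrow> f x = 0"
    using assms by (rule cont_bsuppE) blast
  have "compact (f ` cball 0 r)"
    using assms by (intro compact_continuous_image) (auto simp: cont_bsupp_def intro:
        continuous_on_subset)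
  then obtain B where B: "\<And>x. x \<in> cball 0 r \<Longrightarrow> norm (f x) \<le> B"
    by (metis bounded_iff compact_imp_bounded imageI)
  have "norm (f x) \<le> max B 0" for x
    using B[of x] r[of x] by (cases "norm x > r") (auto simp: le_max_iff_disj)
  then show ?thesis by (rule that) simp
qed

section \<open>Exchanging directions in products of first derivatives\<close>

lemma integral_lborel_translate:
  fixes f :: "'a::euclidean_space \<Rightarrow> real"
  assumes "continuous_on UNIV f"
  shows "(LINT x|lborel. f (x + c)) = (LINT x|lborel. f x)"
proof -
  have [measurable]: "f \<in> borel_measurable borel"
    using assms by (rule borel_measurable_continuous_onI)
  have "(LINT x|lborel. f x) = (LINT x|distr lborel borel ((+) c). f x)"
    by (simp only: lborel_distr_plus)
  also have "\<dots> = (LINT x|lborel. f (x + c))"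
    by (subst integral_distr) (auto simp: add.commute)
  finally show ?thesis by simp
qed

text \<open>Expanding both sides leaves four correlations int p(x + c) q(x + d), which by
  translation invariance depend only on d - c. The values b - a, -a, b and 0 occur on both sides
  with the same signs.\<close>

lemma integral_difference_exchange:
  fixes p q :: "'a::euclidean_space \<Rightarrow> real"
  assumes p: "cont_bsupp p" and q: "cont_bsupp q"
  shows "(LINT x|lborel. (p (x + a) - p x) * (q (x + b) - q x)) =
         (LINT x|lborel. (p (x - b) - p x) * (q (x - a) - q x))"
proof -
  have cp: "continuous_on UNIV (\<lambda>x. p (x + c))" and cq: "continuous_on UNIV (\<lambda>x. q (x + c))" for c
    using cont_bsupp_translate[OF p] cont_bsupp_translate[OF q] by (auto simp: cont_bsupp_def)
  have int: "integrable lborel (\<lambda>x. p (x + c) * q (x + d))" for c d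
    by (intro cont_bsupp_integrable cont_bsupp_mult cont_bsupp_translate p cq)
  have shift: "(LINT x|lborel. p (x + c) * q (x + d)) =
      (LINT x|lborel. p (x + (c + e)) * q (x + (d + e)))" for c d e
    using integral_lborel_translate[of "\<lambda>x. p (x + c) * q (x + d)" e, symmetric]
    by (simp add: cp cq continuous_on_mult add_ac)
  have expand: "(LINT x|lborel. (p (x + c) - p x) * (q (x + d) - q x)) = 
      (LINT x|lborel. p (x + c) * q (x + d)) - (LINT x|lborel. p (x + c) * q (x + 0))
      - ((LINT x|lborel. p (x + 0) * q (x + d)) - (LINT x|lborel. p (x + 0) * q (x + 0)))" for c d
  proof -
    have "(\<lambda>x. (p (x + c) - p x) * (q (x + d) - q x)) =
        (\<lambda>x. (p (x + c) * q (x + d) - p (x + c) * q (x + 0))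
        - (p (x + 0) * q (x + d) - p (x + 0) * q (x + 0)))"
      by (auto simp: algebra_simps)
    then show ?thesis
      by (simp only: Bochner_Integration.integral_diff Bochner_Integration.integrable_diff int)
  qed
  show ?thesis
    using expand[of a b] expand[of "-b" "-a"] shift[of a b "- a - b"] shift[of a 0 "-a"] shift[of
        0 b "-b"]
    by simp
qed

lemma has_real_derivative_along_line:
  fixes p :: "'a::euclidean_space \<Rightarrow> real"
  assumes "\<And>x. (p has_derivative (\<lambda>h. P x \<bullet> h)) (at x)"
  shows "((\<lambda>s. p (x + s *\<^sub>R a)) has_real_derivative (P (x + s *\<^sub>R a) \<bullet> a)) (at s)"
proof -
  have "((\<lambda>s. x + s *\<^sub>R a) has_derivative (\<lambda>h. h *\<^sub>R a)) (at s)"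
    by (auto intro!: derivative_eq_intros)
  then have "((\<lambda>s. p (x + s *\<^sub>R a)) has_derivative (\<lambda>h. P (x + s *\<^sub>R a) \<bullet> (h *\<^sub>R a))) (at s)"
    using assms by (rule has_derivative_compose)
  then show ?thesis
    by (simp add: has_field_derivative_def mult_commute_abs)
qed

lemma difference_quotient_tendsto:
  fixes p :: "'a::euclidean_space \<Rightarrow> real"
  assumes "\<And>x. (p has_derivative (\<lambda>h. P x \<bullet> h)) (at x)"
    and t: "t \<longlonglongrightarrow> (0::real)" "\<And>n. t n \<noteq> 0"
  shows "(\<lambda>n. (p (x + t n *\<^sub>R a) - p x) / t n) \<longlonglongrightarrow> P x \<bullet> a"
proof -
  have "((\<lambda>h. (p (x + h *\<^sub>R a) - p x) / h) \<longlongrightarrow> P x \<bullet> a) (at 0)"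
    using has_real_derivative_along_line[OF assms(1), of x a 0] by (simp add: DERIV_def)
  moreover have "filterlim t (at 0) sequentially"
    using t by (auto simp: filterlim_at)
  ultimately show ?thesis by (rule filterlim_compose)
qed

lemma abs_difference_le:
  fixes p :: "'a::euclidean_space \<Rightarrow> real"
  assumes "\<And>x. (p has_derivative (\<lambda>h. P x \<bullet> h)) (at x)" and B: "\<And>x. norm (P x) \<le> B"
  shows "\<bar>p (x + v) - p x\<bar> \<le> B * norm v"
proof -
  have "norm (p (x + v) - p x) \<le> B * norm ((x + v) - x)"
  proof (rule differentiable_bound[of UNIV p "\<lambda>x h. P x \<bullet> h"])
    fix x
    have "\<bar>P x \<bullet> h\<bar> \<le> B * norm h" for h
      using Cauchy_Schwarz_ineq2[of "P x" h] B[of x]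
          by (meson mult_right_mono norm_ge_zero order_trans)
    then show "onorm (\<lambda>h. P x \<bullet> h) \<le> B"
      by (intro onorm_le) simp
  qed (use assms in auto)
  then show ?thesis by simp
qed

lemma difference_quotient_integral_tendsto:
  fixes p q :: "'a::euclidean_space \<Rightarrow> real"
  assumes p: "cont_bsupp p" "\<And>x. (p has_derivative (\<lambda>h. P x \<bullet> h)) (at x)" "cont_bsupp P"
    and q: "cont_bsupp q" "\<And>x. (q has_derivative (\<lambda>h. Q x \<bullet> h)) (at x)" "cont_bsupp Q"
    and t: "t \<longlonglongrightarrow> (0::real)" "\<And>n. t n \<noteq> 0" "\<And>n. \<bar>t n\<bar> \<le> 1"
  shows "(\<lambda>n. LINT x|lborel. ((p (x + t n *\<^sub>R a) - p x) / t n) * ((q (x + t n *\<^sub>R b) - q x) / t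
      n))
     \<longlonglongrightarrow> (LINT x|lborel. (P x \<bullet> a) * (Q x \<bullet> b))"
proof -
  obtain B where B: "\<And>x. norm (P x) \<le> B" "B \<ge> 0" using p(3) by (rule cont_bsupp_bounded) blast
  obtain C where C: "\<And>x. norm (Q x) \<le> C" "C \<ge> 0" using q(3) by (rule cont_bsupp_bounded) blast
  obtain r where r: "\<And>x. norm x > r \<Longrightarrow> p x = 0" using p(1) by (rule cont_bsuppE) blast
  \<comment> \<open>As |t n| \<le> 1, both \<open>p x\<close> and
    \<open>p (x + t n *\<^sub>R a)\<close> vanish outside this ball, so the product is dominated by
    a constant on the ball.\<close>
  define K where "K = cball (0::'a) (r + norm a)"
  define w where "w = (\<lambda>x. indicator K x *\<^sub>R ((B * norm a) * (C * norm b)))"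
  have cont: "continuous_on UNIV p" "continuous_on UNIV q" "continuous_on UNIV P" "continuous_on
      UNIV Q"
    using p q by (auto simp: cont_bsupp_def)
  have cp: "continuous_on UNIV (\<lambda>x. p (x + c))" and cq: "continuous_on UNIV (\<lambda>x. q (x + c))" for c
    using cont_bsupp_translate[OF p(1)] cont_bsupp_translate[OF q(1)]
        by (auto simp: cont_bsupp_def)
  have quot: "\<bar>(p (x + t n *\<^sub>R a) - p x) / t n\<bar> \<le> B * norm a" "\<bar>(q (x + t n *\<^sub>R b) - q x) / t n\<bar> \<le>
      C * norm b" for n x
    using abs_difference_le[OF p(2) B(1), of x "t n *\<^sub>R a"] abs_difference_le[OF q(2) C(1), of x
        "t n *\<^sub>R b"] t(2)[of n]
    by (auto simp: field_simps)
  show ?thesis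
  proof (rule integral_dominated_convergence[where w = w])
    show "(\<lambda>x. P x \<bullet> a * (Q x \<bullet> b)) \<in> borel_measurable lborel"
      using cont by (simp add: borel_measurable_continuous_onI continuous_on_mult
          continuous_on_inner)
    show "(\<lambda>x. (p (x + t n *\<^sub>R a) - p x) / t n * ((q (x + t n *\<^sub>R b) - q x) / t n)) \<in>
        borel_measurable lborel" for n
      using cont cp cq t(2)[of n]
      by (auto intro!: borel_measurable_continuous_onI continuous_intros)
    show "integrable lborel w"
      unfolding w_def by (rule borel_integrable_compact) (auto simp: K_def)
    show "AE x in lborel. (\<lambda>n. (p (x + t n *\<^sub>R a) - p x) / t n * ((q (x + t n *\<^sub>R b) - q x) / t
        n))
        \<longlonglongrightarrow> P x \<bullet> a * (Q x \<bullet> b)"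
      by (intro AE_I2 tendsto_mult difference_quotient_tendsto p q t)
    show "AE x in lborel. norm ((p (x + t n *\<^sub>R a) - p x) / t n * ((q (x + t n *\<^sub>R b) - q x) / t
        n)) \<le> w x" for n
    proof (rule AE_I2)
      fix x
      show "norm ((p (x + t n *\<^sub>R a) - p x) / t n * ((q (x + t n *\<^sub>R b) - q x) / t n)) \<le> w x"
      proof (cases "x \<in> K")
        case True
        then show ?thesis
          using mult_mono[OF quot(1)[of x n] quot(2)[of x n]] B(2) by (simp add: w_def abs_mult)
      next
        case False
        then have "norm x > r + norm a" by (simp add: K_def)
        moreover have "norm (t n *\<^sub>R a) \<le> norm a"
            using t(3)[of n] by (simp add: mult_left_le_one_le)
        moreover have "norm x \<le> norm (x + t n *\<^sub>R a) + norm (t n *\<^sub>R a)"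
          by (metis add_diff_cancel_right' norm_triangle_ineq4)
        ultimately have "norm x > r" "norm (x + t n *\<^sub>R a) > r"
          using norm_ge_zero[of a] by linarith+
        then show ?thesis using r False by (simp add: w_def)
      qed
    qed
  qed
qed

text \<open>Integrating by parts twice would need third derivatives. Instead, the identity is exact for
  difference quotients with steps \<open>t\<close> and \<open>- t\<close>, and \<open>t\<close> tends to zero.\<close>

lemma integral_gradient_exchange:
  fixes p q :: "'a::euclidean_space \<Rightarrow> real"
  assumes p: "cont_bsupp p" "\<And>x. (p has_derivative (\<lambda>h. P x \<bullet> h)) (at x)" "cont_bsupp P"
    and q: "cont_bsupp q" "\<And>x. (q has_derivative (\<lambda>h. Q x \<bullet> h)) (at x)" "cont_bsupp Q"
  shows "(LINT x|lborel. (P x \<bullet> a) * (Q x \<bullet> b)) = (LINT x|lborel. (P x \<bullet> b) * (Q x \<bullet> a))"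
proof -
  define t where "t = (\<lambda>n. inverse (real (Suc n)))"
  have t: "t \<longlonglongrightarrow> 0" "\<And>n. t n \<noteq> 0" "\<And>n. \<bar>t n\<bar> \<le> 1"
    unfolding t_def by (rule LIMSEQ_inverse_real_of_nat) (auto simp: field_simps)
  have t': "(\<lambda>n. - t n) \<longlonglongrightarrow> 0" "\<And>n. - t n \<noteq> 0" "\<And>n. \<bar>- t n\<bar> \<le> 1"
    using t tendsto_minus[OF t(1)] by auto
  have exchange: "(LINT x|lborel. ((p (x + t n *\<^sub>R a) - p x) / t n) * ((q (x + t n *\<^sub>R b) - q x) /
      t n)) =
     (LINT x|lborel. ((p (x + (- t n) *\<^sub>R b) - p x) / - t n) * ((q (x + (- t n) *\<^sub>R a) - q x) / -
         t n))" for n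
  proof -
    have eq: "y / s * (z / s) = inverse (s * s) * (y * z)" for y z s :: real
      by (simp add: divide_inverse)
    show ?thesis
      unfolding eq integral_mult_right_zero
      using integral_difference_exchange[OF p(1) q(1), of "t n *\<^sub>R a" "t n *\<^sub>R b"] by simp
  qed
  have "(\<lambda>n. LINT x|lborel. ((p (x + t n *\<^sub>R a) - p x) / t n) * ((q (x + t n *\<^sub>R b) - q x) / t n))
     \<longlonglongrightarrow> (LINT x|lborel. (P x \<bullet> b) * (Q x \<bullet> a))"
    unfolding exchange by (rule difference_quotient_integral_tendsto[OF p q t'])
  with difference_quotient_integral_tendsto[OF p q t, of a b] show ?thesis
    by (rule LIMSEQ_unique)
qed

text \<open>The second difference is the increment in direction \<open>b\<close> of an increment in
  direction \<open>a\<close>. The mean value theorem along \<open>b\<close> turns it into an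
  increment of g \<bullet> b along \<open>a\<close>, to which the theorem is applied once
  more.\<close>

lemma second_difference_mvt:
  fixes u :: "'a::euclidean_space \<Rightarrow> real"
  assumes u: "\<And>x. (u has_derivative (\<lambda>h. g x \<bullet> h)) (at x)"
    and g: "\<And>x. (g has_derivative D x) (at x)" and t: "t > 0"
  shows "\<exists>y. norm (y - x) \<le> t * (norm a + norm b) \<and>
    u (x + t *\<^sub>R b + t *\<^sub>R a) - u (x + t *\<^sub>R b) - u (x + t *\<^sub>R a) + u x = t * t * (D y a \<bullet> b)"
proof -
  have "((\<lambda>s. u (x + t *\<^sub>R a + s *\<^sub>R b) - u (x + s *\<^sub>R b)) has_real_derivative 
     (g (x + t *\<^sub>R a + s *\<^sub>R b) \<bullet> b - g (x + s *\<^sub>R b) \<bullet> b)) (at s)" for s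
    by (intro DERIV_diff has_real_derivative_along_line u)
  from MVT2[OF t this] obtain \<xi> where \<xi>: "0 < \<xi>" "\<xi> < t"
    "u (x + t *\<^sub>R a + t *\<^sub>R b) - u (x + t *\<^sub>R b) - (u (x + t *\<^sub>R a + 0 *\<^sub>R b) - u (x + 0 *\<^sub>R b)) =
       (t - 0) * (g (x + t *\<^sub>R a + \<xi> *\<^sub>R b) \<bullet> b - g (x + \<xi> *\<^sub>R b) \<bullet> b)" by blast
  have "((\<lambda>s. g (x + \<xi> *\<^sub>R b + s *\<^sub>R a) \<bullet> b) has_real_derivative (D (x + \<xi> *\<^sub>R b + s *\<^sub>R a) a \<bullet>
      b)) (at s)" for s
  proof -
    have "((\<lambda>s. x + \<xi> *\<^sub>R b + s *\<^sub>R a) has_derivative (\<lambda>h. h *\<^sub>R a)) (at s)"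
      by (auto intro!: derivative_eq_intros)
    from has_derivative_compose[OF this g]
    have "((\<lambda>s. g (x + \<xi> *\<^sub>R b + s *\<^sub>R a) \<bullet> b)
        has_derivative (\<lambda>h. D (x + \<xi> *\<^sub>R b + s *\<^sub>R a) (h *\<^sub>R a) \<bullet> b)) (at s)"
      by (rule has_derivative_inner_left)
    moreover have "linear (D y)" for y
      using g[of y] has_derivative_linear by blast
    ultimately show ?thesis
      by (simp add: has_field_derivative_def linear_scale mult_commute_abs)
  qed
  from MVT2[OF t this] obtain \<eta> where \<eta>: "0 < \<eta>" "\<eta> < t"
    "g (x + \<xi> *\<^sub>R b + t *\<^sub>R a) \<bullet> b - g (x + \<xi> *\<^sub>R b + 0 *\<^sub>R a) \<bullet> b =
        (t - 0) * (D (x + \<xi> *\<^sub>R b + \<eta> *\<^sub>R a) a \<bullet> b)"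
    by blast
  let ?y = "x + \<xi> *\<^sub>R b + \<eta> *\<^sub>R a"
  have "norm (?y - x) \<le> norm (\<xi> *\<^sub>R b) + norm (\<eta> *\<^sub>R a)"
    using norm_triangle_ineq[of "\<xi> *\<^sub>R b" "\<eta> *\<^sub>R a"] by (simp add: algebra_simps)
  also have "\<dots> \<le> t * norm b + t * norm a"
    using \<xi> \<eta> by (intro add_mono) (auto intro!: mult_right_mono)
  finally have "norm (?y - x) \<le> t * (norm a + norm b)" by (simp add: algebra_simps)
  moreover have "u (x + t *\<^sub>R b + t *\<^sub>R a) - u (x + t *\<^sub>R b) - u (x + t *\<^sub>R a) + u x =
      t * t * (D ?y a \<bullet> b)"
    using \<xi>(3) \<eta>(3) by (simp add: algebra_simps)
  ultimately show ?thesis by blast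
qed

text \<open>The second difference is symmetric in \<open>a\<close> and \<open>b\<close>; divided by
  t^2 it tends to \<open>D x a \<bullet> b\<close>, by its mean value form and the continuity of
  \<open>D\<close>.\<close>

lemma symmetric_second_derivative:
  fixes u :: "'a::euclidean_space \<Rightarrow> real"
  assumes u: "\<And>x. (u has_derivative (\<lambda>h. g x \<bullet> h)) (at x)"
    and g: "\<And>x. (g has_derivative D x) (at x)" and cont: "\<And>h. continuous_on UNIV (\<lambda>x. D x h)"
  shows "D x a \<bullet> b = D x b \<bullet> a"
proof -
  define t where "t = (\<lambda>n. inverse (real (Suc n)))"
  have t: "t \<longlonglongrightarrow> 0" "\<And>n. t n > 0"
    unfolding t_def by (rule LIMSEQ_inverse_real_of_nat) auto
  define \<Delta> where "\<Delta> = (\<lambda>n a b. u (x + t n *\<^sub>R b + t n *\<^sub>R a) - u (x + t n *\<^sub>R b) - u (x + t n *\<^sub>R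
      a) + u x)"
  have lim: "(\<lambda>n. \<Delta> n a b / (t n * t n)) \<longlonglongrightarrow> D x a \<bullet> b" for a b
  proof -
    obtain y where y: "\<And>n. norm (y n - x) \<le> t n * (norm a + norm b)"
        "\<And>n. \<Delta> n a b = t n * t n * (D (y n) a \<bullet> b)"
      using second_difference_mvt[OF u g t(2), of x _ a b] unfolding \<Delta>_def by metis
    have "(\<lambda>n. t n * (norm a + norm b)) \<longlonglongrightarrow> 0 * (norm a + norm b)"
      by (intro tendsto_intros t)
    then have "(\<lambda>n. y n - x) \<longlonglongrightarrow> 0"
      by (intro Lim_null_comparison[OF always_eventually[OF allI[OF y(1)]]]) simp
    then have "y \<longlonglongrightarrow> x" by (rule LIM_zero_cancel)
    moreover have cont': "isCont (\<lambda>x. D x a \<bullet> b) x"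
      using cont[of a] by (intro isCont_inner) (auto simp: continuous_on_eq_continuous_at)
    ultimately have "(\<lambda>n. D (y n) a \<bullet> b) \<longlonglongrightarrow> D x a \<bullet> b"
      using isCont_tendsto_compose[OF cont'] by blast
    moreover have "\<Delta> n a b / (t n * t n) = D (y n) a \<bullet> b" for n
      using t(2)[of n] by (simp add: y(2))
    ultimately show ?thesis by simp
  qed
  have "\<Delta> n a b = \<Delta> n b a" for n by (simp add: \<Delta>_def algebra_simps)
  then show ?thesis using lim[of a b] lim[of b a] LIMSEQ_unique by simp
qed

section \<open>Test functions for the buckling problem\<close>

text \<open>The complement of the closed support is open and \<open>u\<close> vanishes on it, so the
  gradient and then the Hessian vanish there too.\<close>

lemma C2_test_cont_bsupp:
  assumes "C2_test D u g H"
  shows "cont_bsupp u" "cont_bsupp g" "cont_bsupp H"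
proof -
  define K where "K = closure {x. u x \<noteq> 0}"
  have u: "\<And>x. (u has_derivative (\<lambda>h. g x \<bullet> h)) (at x)"
    and g: "\<And>x. (g has_derivative (\<lambda>h. H x *v h)) (at x)"
    and H: "continuous_on UNIV H" and K: "compact K"
    using assms by (auto simp: C2_test_def K_def)
  have K_open: "open (- K)" and bK: "bounded K"
    using K by (simp_all add: compact_imp_bounded compact_imp_closed open_Compl)
  have u0: "u x = 0" if "x \<in> - K" for x
    using that closure_subset[of "{x. u x \<noteq> 0}"] by (auto simp: K_def)
  have g0: "g x = 0" if x: "x \<in> - K" for x
  proof -
    have "((\<lambda>x. 0) has_derivative (\<lambda>h. g x \<bullet> h)) (at x)"
      by (rule has_derivative_transform_within_open[OF u K_open x]) (simp add: u0)
    then have "(\<lambda>h. g x \<bullet> h) = (\<lambda>h. 0)"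
      using has_derivative_unique[OF _ has_derivative_const] by blast
    then show ?thesis by (metis inner_eq_zero_iff)
  qed
  have H0: "H x = 0" if x: "x \<in> - K" for x
  proof -
    have "((\<lambda>x. 0) has_derivative (\<lambda>h. H x *v h)) (at x)"
      by (rule has_derivative_transform_within_open[OF g K_open x]) (simp add: g0)
    then have "(\<lambda>h. H x *v h) = (\<lambda>h. 0)"
      using has_derivative_unique[OF _ has_derivative_const] by blast
    then show ?thesis by (metis matrix_eq matrix_vector_mult_0)
  qed
  have "continuous_on UNIV u" "continuous_on UNIV g"
    using u g by (auto intro!: has_derivative_continuous_on simp: has_derivative_at_withinI)
  moreover have "bounded {x. u x \<noteq> 0}" "bounded {x. g x \<noteq> 0}" "bounded {x. H x \<noteq> 0}"
    using u0 g0 H0 by (auto intro!: bounded_subset[OF bK])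
  ultimately show "cont_bsupp u" "cont_bsupp g" "cont_bsupp H"
    using H by (auto simp: cont_bsupp_def)
qed

lemma cont_bsupp_nth:
  assumes "cont_bsupp f"
  shows "cont_bsupp (\<lambda>x. f x $ i)"
proof -
  have "bounded {x. f x $ i \<noteq> 0}"
    by (rule bounded_subset[of "{x. f x \<noteq> 0}"]) (use assms in \<open>auto simp: cont_bsupp_def\<close>)
  then show ?thesis
    using assms by (auto simp: cont_bsupp_def intro!: continuous_intros)
qed

lemma C2_test_hessian_symmetric:
  assumes "C2_test D u g H"
  shows "H x $ i $ j = H x $ j $ i"
proof -
  have H: "continuous_on UNIV H"
    using assms by (auto simp: C2_test_def)
  have "continuous_on UNIV (\<lambda>x. H x *v h)" for h
    unfolding matrix_vector_mult_def by (intro continuous_intros H)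
  then have "(H x *v axis j 1) \<bullet> axis i 1 = (H x *v axis i 1) \<bullet> axis j 1"
    using assms symmetric_second_derivative[of u g "\<lambda>x h. H x *v h"] by (auto simp: C2_test_def)
  then show ?thesis by (simp add: inner_axis matrix_vector_mul_component)
qed

text \<open>This is the exchange of directions for the first derivatives u_i and u_k. With the
  symmetry of the Hessian it makes the correlation totally symmetric.\<close>

lemma hessian_correlation_exchange:
  assumes "C2_test D u g H"
  shows "(LINT x|lborel. H x$i$j * H x$k$l) = (LINT x|lborel. H x$i$l * H x$k$j)"
proof -
  note bs = C2_test_cont_bsupp[OF assms]
  have d: "((\<lambda>x. g x $ i) has_derivative (\<lambda>h. H x $ i \<bullet> h)) (at x)" for i x
  proof -
    have "(g has_derivative (\<lambda>h. H x *v h)) (at x)" using assms by (auto simp: C2_test_def)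
    from bounded_linear.has_derivative[OF bounded_linear_vec_nth this, of i]
    show ?thesis by (simp add: matrix_vector_mul_component)
  qed
  show ?thesis
    using integral_gradient_exchange[OF cont_bsupp_nth[OF bs(2)] d cont_bsupp_nth[OF bs(3)]
        cont_bsupp_nth[OF bs(2)] d cont_bsupp_nth[OF bs(3)], of i "axis j 1" k "axis l 1"]
    by (simp add: inner_axis)
qed

text \<open>Zero energy makes \<open>g\<close> vanish almost everywhere; the set where it does not
  vanish is open, hence empty, so \<open>u\<close> is constant and its bounded support forces it to
  be 0. Positivity matters because a zero denominator would give the quotient the value 0.\<close>

lemma gradient_energy_pos:
  assumes test: "C2_test D u g H" and u: "u x0 \<noteq> 0"
  shows "(LINT x|lborel. (norm (g x))\<^sup>2) > 0"
proof (rule ccontr)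
  assume "\<not> ?thesis"
  then have zero: "(LINT x|lborel. (norm (g x))\<^sup>2) = 0"
    by (simp add: order_antisym_conv not_less)
  note bs = C2_test_cont_bsupp[OF test]
  have cg: "continuous_on UNIV g" using bs by (auto simp: cont_bsupp_def)
  have "cont_bsupp (\<lambda>x. (norm (g x))\<^sup>2)"
    using bs(2) by (auto simp: cont_bsupp_def intro!: continuous_intros)
  then have "integrable lborel (\<lambda>x. (norm (g x))\<^sup>2)" by (rule cont_bsupp_integrable)
  then have ae: "AE x in lborel. (norm (g x))\<^sup>2 = 0"
    using zero by (subst (asm) integral_nonneg_eq_0_iff_AE) auto
  have op: "open {x. g x \<noteq> 0}"
    using cg by (intro open_Collect_neq continuous_on_const)
  then have "{x. g x \<noteq> 0} \<in> null_sets lborel"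
    using ae by (subst (asm) AE_iff_null) auto
  then have "negligible {x. g x \<noteq> 0}"
    by (simp add: negligible_iff_null_sets null_sets_completionI)
  then have g0: "g x = 0" for x
    using open_not_negligible[OF op] by auto
  have "(u has_derivative (\<lambda>h. 0)) (at x)" for x
  proof -
    have "(u has_derivative (\<lambda>h. g x \<bullet> h)) (at x)" using test by (auto simp: C2_test_def)
    moreover have "(\<lambda>h. g x \<bullet> h) = (\<lambda>h. 0)" by (simp add: g0)
    ultimately show ?thesis by simp
  qed
  then obtain c where c: "\<And>x. u x = c"
    using has_derivative_zero_constant[of UNIV u] by auto
  obtain r where r: "\<And>x. norm x > r \<Longrightarrow> u x = 0"
    using bs(1) by (rule cont_bsuppE) blast
  obtain y :: "real^'a" where "norm y = max (r + 1) 0"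
      using vector_choose_size[of "max (r + 1) 0"] by auto
  then show False using r[of y] c u by simp
qed

section \<open>Pullback by linear maps and Rayleigh quotients\<close>

lemma C2_test_pullback:
  assumes test: "C2_test D u g H" and inv: "N ** N' = mat 1" "N' ** N = mat 1"
  shows "C2_test ((\<lambda>x. N' *v x) ` D) (\<lambda>y. u (N *v y)) (\<lambda>y. transpose N *v g (N *v y))
     (\<lambda>y. transpose N ** H (N *v y) ** N)"
proof -
  have u: "\<And>x. (u has_derivative (\<lambda>h. g x \<bullet> h)) (at x)"
    and g: "\<And>x. (g has_derivative (\<lambda>h. H x *v h)) (at x)"
    and H: "continuous_on UNIV H" and K: "compact (closure {x. u x \<noteq> 0})" "closure {x. u x \<noteq> 0} \<subseteq>
        D"
    using test by (auto simp: C2_test_def)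
  have N: "((\<lambda>y. N *v y) has_derivative (\<lambda>h. N *v h)) (at y)" for y
    by (intro bounded_linear_imp_has_derivative matrix_vector_mul_bounded_linear)
  have u': "((\<lambda>y. u (N *v y)) has_derivative (\<lambda>h. (transpose N *v g (N *v y)) \<bullet> h)) (at y)" for y
    using has_derivative_compose[OF N u] by (simp add: dot_lmul_matrix)
  have g': "((\<lambda>y. transpose N *v g (N *v y)) has_derivative
      (\<lambda>h. (transpose N ** H (N *v y) ** N) *v h)) (at y)" for y
    using bounded_linear.has_derivative[OF matrix_vector_mul_bounded_linear
        has_derivative_compose[OF N g], of "transpose N" y]
    by (simp add: matrix_vector_mul_assoc matrix_mul_assoc)
  have "continuous_on UNIV (\<lambda>y. N *v y)"
    by (intro linear_continuous_on matrix_vector_mul_bounded_linear)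
  then have "continuous_on UNIV (\<lambda>y. H (N *v y))"
    by (rule continuous_on_compose2[OF H]) auto
  then have H': "continuous_on UNIV (\<lambda>y. transpose N ** H (N *v y) ** N)"
    unfolding matrix_matrix_mult_def by (intro continuous_intros)
  let ?K = "(\<lambda>x. N' *v x) ` closure {x. u x \<noteq> 0}"
  have comp: "compact ?K"
    by (intro compact_continuous_image K linear_continuous_on matrix_vector_mul_bounded_linear)
  have "{y. u (N *v y) \<noteq> 0} \<subseteq> ?K"
  proof
    fix y assume "y \<in> {y. u (N *v y) \<noteq> 0}"
    moreover have "y = N' *v (N *v y)" by (simp add: matrix_vector_mul_assoc inv)
    ultimately show "y \<in> ?K" using closure_subset[of "{x. u x \<noteq> 0}"] by blast
  qed
  then have sub: "closure {y. u (N *v y) \<noteq> 0} \<subseteq> ?K"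
    using comp by (intro closure_minimal compact_imp_closed)
  have "compact (closure {y. u (N *v y) \<noteq> 0})"
    using bounded_subset[OF compact_imp_bounded[OF comp] sub]
        by (simp add: compact_eq_bounded_closed)
  moreover have "closure {y. u (N *v y) \<noteq> 0} \<subseteq> (\<lambda>x. N' *v x) ` D"
    using sub image_mono[OF K(2)] by (rule subset_trans)
  ultimately show ?thesis
    using u' g' H' unfolding C2_test_def by blast
qed

lemma integral_linear_exchange:
  fixes F G :: "'a::euclidean_space \<Rightarrow> real" and N N' :: "'a \<Rightarrow> 'a"
  assumes F: "cont_bsupp F" "\<And>x. F x \<ge> 0" and G: "cont_bsupp G" "\<And>x. G x \<ge> 0"
    and FN: "cont_bsupp (\<lambda>y. F (N y))" and GN: "cont_bsupp (\<lambda>y. G (N y))"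
    and N: "linear N" "\<And>x. N (N' x) = x"
  shows "(LINT x|lborel. F x) * (LINT y|lborel. G (N y)) =
      (LINT y|lborel. F (N y)) * (LINT x|lborel. G x)"
proof -
  have [measurable]: "F \<in> borel_measurable borel" "G \<in> borel_measurable borel"
    using F G by (auto simp: cont_bsupp_def intro: borel_measurable_continuous_onI)
  have nn: "(\<integral>\<^sup>+x. ennreal (f x) \<partial>lborel) = ennreal (LINT x|lborel. f x)"
    if "cont_bsupp f" "\<And>x. f x \<ge> 0" for f :: "'a \<Rightarrow> real"
    using that by (intro nn_integral_eq_integral cont_bsupp_integrable) auto
  have "ennreal ((LINT x|lborel. F x) * (LINT y|lborel. G (N y))) =
      ennreal ((LINT y|lborel. F (N y)) * (LINT x|lborel. G x))"
    using nn_integral_linear_exchange[of "\<lambda>x. ennreal (F x)" "\<lambda>x. ennreal (G x)" N N'] N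
    by (simp add: nn F G FN GN ennreal_mult[symmetric] Bochner_Integration.integral_nonneg)
  then show ?thesis
    by (subst (asm) ennreal_inj) (auto simp: F G Bochner_Integration.integral_nonneg)
qed

lemma square_double_sum:
  fixes a :: "'a::finite \<Rightarrow> 'b::finite \<Rightarrow> real"
  shows "(\<Sum>i\<in>UNIV. \<Sum>j\<in>UNIV. a i j)\<^sup>2 = 
    (\<Sum>i\<in>UNIV. \<Sum>j\<in>UNIV. \<Sum>k\<in>UNIV. \<Sum>l\<in>UNIV. a i j * a k l)"
  unfolding power2_eq_square sum_distrib_right unfolding sum_distrib_left ..

lemma cont_bsupp_zero_preserving:
  assumes f: "cont_bsupp f" and h: "continuous_on UNIV h" "h 0 = 0"
  shows "cont_bsupp (\<lambda>x. h (f x))"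
proof -
  have "bounded {x. h (f x) \<noteq> 0}"
    by (rule bounded_subset[of "{x. f x \<noteq> 0}"]) (use f h(2) in \<open>auto simp: cont_bsupp_def\<close>)
  then show ?thesis
    using f by (auto simp: cont_bsupp_def intro: continuous_on_compose2[OF h(1)])
qed

lemma C2_test_energies:
  assumes "C2_test D u g H"
  shows "cont_bsupp (\<lambda>x. (trace (H x))\<^sup>2)" "cont_bsupp (\<lambda>x. (norm (g x))\<^sup>2)"
proof -
  note bs = C2_test_cont_bsupp[OF assms]
  show "cont_bsupp (\<lambda>x. (trace (H x))\<^sup>2)"
    by (rule cont_bsupp_zero_preserving[OF bs(3), of "\<lambda>A. (trace A)\<^sup>2"])
      (auto intro!: continuous_intros simp: trace_def)
  show "cont_bsupp (\<lambda>x. (norm (g x))\<^sup>2)"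
    by (rule cont_bsupp_zero_preserving[OF bs(2), of "\<lambda>v. (norm v)\<^sup>2"])
      (auto intro!: continuous_intros)
qed

text \<open>\<open>buckling\<close> is stated with the Henstock-Kurzweil integral, while the
  identities above are for the Bochner integral.\<close>

lemma integral_UNIV_eq_lborel: "cont_bsupp f \<Longrightarrow> integral UNIV f = (LINT x|lborel. f x)"
  for f :: "'a::euclidean_space \<Rightarrow> real"
  by (intro integral_lborel cont_bsupp_integrable)

lemma buckling_le_quotient:
  assumes test: "C2_test D u g H" and u: "u x0 \<noteq> 0"
  shows "buckling D \<le> (LINT x|lborel. (trace (H x))\<^sup>2) / (LINT x|lborel. (norm (g x))\<^sup>2)"
proof -
  have "buckling D \<le> integral UNIV (\<lambda>x. (trace (H x))\<^sup>2) / integral UNIV (\<lambda>x. (norm (g x))\<^sup>2)"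
    unfolding buckling_def
  proof (rule cInf_lower)
    \<comment> \<open>\<open>Inf\<close> is a lower bound only for sets that are bounded below; here
      all quotients are nonnegative.\<close>
    show "bdd_below {integral UNIV (\<lambda>x. (trace (H x))\<^sup>2) / integral UNIV (\<lambda>x. (norm (g x))\<^sup>2)
        | u g H. C2_test D u g H \<and> (\<exists>x. u x \<noteq> 0)}"
      by (rule bdd_belowI[of _ 0])
        (auto simp: integral_UNIV_eq_lborel C2_test_energies intro!: divide_nonneg_nonneg
            Bochner_Integration.integral_nonneg)
  qed (use assms in blast)
  then show ?thesis by (simp add: integral_UNIV_eq_lborel C2_test_energies[OF test])
qed

text \<open>The image domain is tested with u(N y). Its Laplacian is tr(R D^2 u) and its squared
  gradient is the product of Du with R Du, both taken at N y, so the sums are the two energies up to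
  a common Jacobian.\<close>

lemma buckling_pullback_inequality:
  fixes g :: "real^'n \<Rightarrow> real^'n" and N N' :: "real^'n^'n"
  assumes test: "C2_test D u g H" and u: "u x0 \<noteq> 0"
    and inv: "N ** N' = mat 1" "N' ** N = mat 1" and R: "R = N ** transpose N"
  shows "buckling ((\<lambda>x. N' *v x) ` D) * (\<Sum>i\<in>UNIV. \<Sum>j\<in>UNIV. R$i$j * (LINT x|lborel. g x$i * g x$j))
      \<le>
    (\<Sum>i\<in>UNIV. \<Sum>j\<in>UNIV. \<Sum>k\<in>UNIV. \<Sum>l\<in>UNIV. R$i$j * R$k$l * (LINT x|lborel. H x$i$j * H x$k$l))"
proof -
  note bs = C2_test_cont_bsupp[OF test]
  have cont: "continuous_on UNIV g" "continuous_on UNIV H" using bs by (auto simp: cont_bsupp_def)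
  define F where "F = (\<lambda>x. (trace (transpose N ** H x ** N))\<^sup>2)"
  define E where "E = (\<lambda>x. (norm (transpose N *v g x))\<^sup>2)"
  let ?L = "buckling ((\<lambda>x. N' *v x) ` D)"
  note pull = C2_test_pullback[OF test inv]
  have R_sym: "R$i$j = R$j$i" for i j
    unfolding R by (simp add: matrix_matrix_mult_def transpose_def mult.commute)
  have F_eq: "F x = (\<Sum>i\<in>UNIV. \<Sum>j\<in>UNIV. \<Sum>k\<in>UNIV. \<Sum>l\<in>UNIV. R$i$j * R$k$l * (H x$i$j * H x$k$l))"
      for x
  proof -
    have "trace (transpose N ** H x ** N) = trace (H x ** R)"
      using trace_mul_sym[of "transpose N" "H x ** N"] by (simp add: R matrix_mul_assoc)
    also have "\<dots> = (\<Sum>i\<in>UNIV. \<Sum>j\<in>UNIV. R$i$j * H x$i$j)"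
      by (simp add: trace_def matrix_matrix_mult_def mult.commute R_sym[of _ "_::'n"])
    finally show ?thesis by (simp add: F_def square_double_sum mult_ac)
  qed
  have E_eq: "E x = (\<Sum>i\<in>UNIV. \<Sum>j\<in>UNIV. R$i$j * (g x$i * g x$j))" for x
  proof -
    have "E x = g x \<bullet> (R *v g x)"
      unfolding E_def power2_norm_eq_inner R
      by (simp add: dot_lmul_matrix matrix_vector_mul_assoc[symmetric])
    then show ?thesis
      by (simp add: inner_vec_def matrix_vector_mult_def sum_distrib_left mult_ac)
  qed
  have int_E: "(LINT x|lborel. E x) = (\<Sum>i\<in>UNIV. \<Sum>j\<in>UNIV. R$i$j * (LINT x|lborel. g x$i * g x$j))"
  proof -
    have "integrable lborel (\<lambda>x. g x$i * g x$j)" for i j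
      using bs(2) cont by (intro cont_bsupp_integrable cont_bsupp_mult cont_bsupp_nth
          continuous_intros)
    then show ?thesis unfolding E_eq by (simp add: integral_sum)
  qed
  have int_F: "(LINT x|lborel. F x) = 
      (\<Sum>i\<in>UNIV. \<Sum>j\<in>UNIV. \<Sum>k\<in>UNIV. \<Sum>l\<in>UNIV. R$i$j * R$k$l * (LINT x|lborel. H x$i$j * H x$k$l))"
  proof -
    have "integrable lborel (\<lambda>x. H x$i$j * H x$k$l)" for i j k l
      using bs(3) cont by (intro cont_bsupp_integrable cont_bsupp_mult cont_bsupp_nth
          continuous_intros)
    then show ?thesis unfolding F_eq by (simp add: integral_sum)
  qed
  \<comment> \<open>Stands in for the change of variables formula: both integrals scale by the same
    factor, which is never computed.\<close>
  have exchange: "(LINT x|lborel. F x) * (LINT y|lborel. E (N *v y)) =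
      (LINT y|lborel. F (N *v y)) * (LINT x|lborel. E x)"
  proof (rule integral_linear_exchange[of F E _ "\<lambda>y. N' *v y"])
    show "cont_bsupp F" unfolding F_def
      by (rule cont_bsupp_zero_preserving[OF bs(3), of "\<lambda>A. (trace (transpose N ** A ** N))\<^sup>2"])
        (auto intro!: continuous_intros simp: matrix_matrix_mult_def trace_def)
    show "cont_bsupp E" unfolding E_def
    proof (rule cont_bsupp_zero_preserving[OF bs(2), of "\<lambda>v. (norm (transpose N *v v))\<^sup>2"])
      have "continuous_on UNIV (\<lambda>v. transpose N *v v)"
        by (intro linear_continuous_on matrix_vector_mul_bounded_linear)
      then show "continuous_on UNIV (\<lambda>v. (norm (transpose N *v v))\<^sup>2)"
        by (intro continuous_on_power continuous_on_norm)
    qed simp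
    show "cont_bsupp (\<lambda>y. F (N *v y))" "cont_bsupp (\<lambda>y. E (N *v y))"
      unfolding F_def E_def using C2_test_energies[OF pull] by simp_all
  qed (simp_all add: F_def E_def matrix_vector_mul_assoc inv)
  have "u (N *v (N' *v x0)) \<noteq> 0" using u by (simp add: matrix_vector_mul_assoc inv)
  note u' = this
  have pos: "(LINT y|lborel. E (N *v y)) > 0"
    using gradient_energy_pos[OF pull u'] by (simp add: E_def)
  have "?L \<le> (LINT y|lborel. F (N *v y)) / (LINT y|lborel. E (N *v y))"
    using buckling_le_quotient[OF pull u'] by (simp add: E_def F_def)
  then have "?L * (LINT y|lborel. E (N *v y)) \<le> (LINT y|lborel. F (N *v y))"
    using pos by (simp add: field_simps)
  then have "?L * (LINT y|lborel. E (N *v y)) * (LINT x|lborel. E x) \<le>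
      (LINT y|lborel. F (N *v y)) * (LINT x|lborel. E x)"
    by (intro mult_right_mono) (auto simp: E_def intro!: Bochner_Integration.integral_nonneg)
  then have "(?L * (LINT x|lborel. E x)) * (LINT y|lborel. E (N *v y)) \<le>
      (LINT x|lborel. F x) * (LINT y|lborel. E (N *v y))"
    unfolding exchange by (simp add: mult_ac)
  then have "?L * (LINT x|lborel. E x) \<le> (LINT x|lborel. F x)"
    using pos by (simp add: mult_le_cancel_right)
  then show ?thesis unfolding int_E int_F .
qed

section \<open>A concrete test function\<close>

lemma DERIV_max_0_power:
  assumes "n \<ge> 1"
  shows "((\<lambda>t. max 0 t ^ Suc n) has_real_derivative (real (Suc n) * max 0 t ^ n)) (at t)"
proof -
  consider "t > 0" | "t < 0" | "t = 0" by linarith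
  then show ?thesis
  proof cases
    case 1
    have "((\<lambda>t. t ^ Suc n) has_real_derivative (real (Suc n) * t ^ n)) (at t)"
      by (auto intro!: derivative_eq_intros simp del: power_Suc)
    then have "((\<lambda>t. max 0 t ^ Suc n) has_real_derivative (real (Suc n) * t ^ n)) (at t)"
      by (rule has_field_derivative_transform_within_open[of _ _ _ "{0<..}"]) (use 1 in auto)
    then show ?thesis using 1 by simp
  next
    case 2
    have "((\<lambda>t. max 0 t ^ Suc n) has_real_derivative 0) (at t)"
      by (rule has_field_derivative_transform_within_open[OF DERIV_const[of 0], where S =
          "{..<0}"]) (use 2 in auto)
    moreover have "real (Suc n) * max 0 t ^ n = 0" using 2 assms by (simp add: max_absorb1)
    ultimately show ?thesis by (simp only:)
  next
    case 3
    \<comment> \<open>At 0 the difference quotient is at most |h|^n in absolute value, which tends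
      to 0 since \<open>n\<close> is at least 1.\<close>
    have "((\<lambda>h::real. max 0 h ^ Suc n / h) \<longlongrightarrow> 0) (at 0)"
    proof (rule Lim_null_comparison)
      show "\<forall>\<^sub>F h in at 0. norm (max 0 h ^ Suc n / h) \<le> \<bar>h\<bar> ^ n"
        by (rule always_eventually) (auto simp: max_def)
      have "((\<lambda>h::real. \<bar>h\<bar> ^ n) \<longlongrightarrow> \<bar>0\<bar> ^ n) (at 0)" by (intro tendsto_intros)
      moreover have "\<bar>0::real\<bar> ^ n = 0" using assms by simp
      ultimately show "((\<lambda>h::real. \<bar>h\<bar> ^ n) \<longlongrightarrow> 0) (at 0)" by (simp only:)
    qed
    then show ?thesis using 3 assms by (cases n) (simp_all add: DERIV_def)
  qed
qed

text \<open>Guarantees that the infimum is over a nonempty set. The function is the cube of the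
  positive part of r^2 - |x - a|^2: its second derivatives contain the positive part as a factor,
  hence are continuous across the sphere.\<close>

lemma C2_test_exists:
  fixes D :: "(real^'n) set"
  assumes "open D" "D \<noteq> {}"
  obtains u g H x0 where "C2_test D u g H" "u x0 \<noteq> 0"
proof -
  obtain a where "a \<in> D" using assms by blast
  then obtain r where r: "r > 0" "cball a r \<subseteq> D" using assms open_contains_cball by metis
  define s where "s = (\<lambda>x. max 0 (r\<^sup>2 - (x - a) \<bullet> (x - a)))"
  define u where "u = (\<lambda>x. s x ^ 3)"
  define g where "g = (\<lambda>x. (- 6 * s x ^ 2) *\<^sub>R (x - a))"
  define H where "H = (\<lambda>x. \<chi> i j. 24 * s x * (x - a)$i * (x - a)$j - 6 * s x ^ 2 * (if i =
      j then 1 else 0))"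
  have w: "((\<lambda>x. r\<^sup>2 - (x - a) \<bullet> (x - a)) has_derivative (\<lambda>h. - (2 * ((x - a) \<bullet> h)))) (at x)"
      for x
    by (auto intro!: derivative_eq_intros simp: inner_commute)
  have chain: "((\<lambda>x. s x ^ Suc n) has_derivative (\<lambda>h. - (2 * ((x - a) \<bullet> h)) * (real (Suc n) * s x
      ^ n))) (at x)"
    if "n \<ge> 1" for n x
    using has_derivative_compose[OF w DERIV_max_0_power[OF that, unfolded
        has_field_derivative_def]]
    by (simp add: s_def mult_ac)
  have "(u has_derivative (\<lambda>h. g x \<bullet> h)) (at x)" for x
    using chain[of 2 x] by (simp add: u_def g_def eval_nat_numeral mult_ac)
  moreover have "(g has_derivative (\<lambda>h. H x *v h)) (at x)" for x
  proof -
    have "((\<lambda>x. s x ^ 2) has_derivative (\<lambda>h. - 4 * s x * ((x - a) \<bullet> h))) (at x)"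
      using chain[of 1 x] by (simp add: eval_nat_numeral mult_ac)
    from has_derivative_mult_right[OF this, of "- 6"]
    have "((\<lambda>x. - 6 * s x ^ 2) has_derivative (\<lambda>h. 24 * s x * ((x - a) \<bullet> h))) (at x)"
      by (simp add: mult_ac)
    moreover have "((\<lambda>x. x - a) has_derivative (\<lambda>h. h)) (at x)"
      by (auto intro!: derivative_eq_intros)
    ultimately have "(g has_derivative (\<lambda>h. (- 6 * s x ^ 2) *\<^sub>R h + (24 * s x * ((x - a) \<bullet> h)) *\<^sub>R
        (x - a))) (at x)"
      unfolding g_def by (rule has_derivative_scaleR)
    moreover have "(- 6 * s x ^ 2) *\<^sub>R h + (24 * s x * ((x - a) \<bullet> h)) *\<^sub>R (x - a) = H x *v h"
        for h
    proof -
      have "(H x *v h) $ i = (24 * s x * ((x - a) \<bullet> h)) * (x - a)$i - 6 * s x ^ 2 * h$i" for i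
      proof -
        have "(H x *v h) $ i = (\<Sum>j\<in>UNIV. (24 * s x * (x - a)$i) * ((x - a)$j * h$j)
            - 6 * s x ^ 2 * (if i = j then h$j else 0))"
          unfolding matrix_vector_mult_def H_def by (auto simp: algebra_simps intro!: sum.cong)
        also have "\<dots> = (24 * s x * ((x - a) \<bullet> h)) * (x - a)$i - 6 * s x ^ 2 * h$i"
          by (simp add: sum_subtractf sum_distrib_left[symmetric] inner_vec_def)
        finally show ?thesis .
      qed
      then show ?thesis by (simp add: vec_eq_iff)
    qed
    ultimately show ?thesis by simp
  qed
  moreover have "continuous_on UNIV H"
    unfolding H_def s_def by (intro continuous_intros)
  moreover have sub: "closure {x. u x \<noteq> 0} \<subseteq> cball a r"
  proof (rule closure_minimal)
    have "norm (x - a) \<le> r" if "u x \<noteq> 0" for x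
    proof -
      have "(x - a) \<bullet> (x - a) \<le> r\<^sup>2" using that
          by (auto simp: u_def s_def max_def split: if_splits)
      then show ?thesis using r(1) by (simp add: power2_norm_eq_inner[symmetric]
          power2_le_iff_abs_le)
    qed
    then show "{x. u x \<noteq> 0} \<subseteq> cball a r" by (auto simp: dist_norm norm_minus_commute)
  qed auto
  moreover have "compact (closure {x. u x \<noteq> 0})"
    using bounded_subset[OF bounded_cball sub] by (simp add: compact_eq_bounded_closed)
  ultimately have "C2_test D u g H"
    using r(2) by (auto simp: C2_test_def)
  moreover have "u a \<noteq> 0" using r(1) by (simp add: u_def s_def)
  ultimately show ?thesis by (rule that)
qed

section \<open>The symmetry group of the domain and the final estimate\<close>

lemma frame_group_sym_group:
  assumes "admits_2_frames \<Omega>"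
  shows "frame_group (sym_group \<Omega>)"
proof
  show "transpose U \<in> sym_group \<Omega>" if "U \<in> sym_group \<Omega>" for U
  proof -
    have U: "orthogonal_matrix U" "(\<lambda>x. U *v x) ` \<Omega> = \<Omega>" using that by (auto simp: sym_group_def)
    have "(\<lambda>x. transpose U *v x) ` \<Omega> = (\<lambda>x. transpose U *v x) ` (\<lambda>x. U *v x) ` \<Omega>"
        by (simp only: U)
    also have "\<dots> = \<Omega>"
      using U(1) by (simp add: image_image matrix_vector_mul_assoc orthogonal_matrix del:
          transpose_matrix_vector)
    finally show ?thesis using U(1) by (simp add: sym_group_def del: transpose_matrix_vector)
  qed
  show "U ** V \<in> sym_group \<Omega>" if "U \<in> sym_group \<Omega>" "V \<in> sym_group \<Omega>" for U V
  proof -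
    have "(\<lambda>x. (U ** V) *v x) ` \<Omega> = (\<lambda>x. U *v x) ` (\<lambda>x. V *v x) ` \<Omega>"
      by (simp add: image_image matrix_vector_mul_assoc)
    then show ?thesis using that by (simp add: sym_group_def orthogonal_matrix_mul)
  qed
qed (use assms in \<open>auto simp: sym_group_def orthogonal_matrix_id admits_2_frames_def\<close>)

theorem theorem7p1:
  fixes \<Omega> :: "(real^'n) set" and T :: "real^'n^'n"
  assumes "bounded_domain \<Omega>" and "admits_2_frames \<Omega>" and "invertible T"
  shows "buckling ((\<lambda>x. T *v x) ` \<Omega>) \<le>
    ((schatten2 (matrix_inv T))^4 + 2 * (schatten4 (matrix_inv T))^4)
      / ((real CARD('n) + 2) * (schatten2 (matrix_inv T))^2) * buckling \<Omega>"
proof -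
  interpret frame_group "sym_group \<Omega>"
    using assms(2) by (rule frame_group_sym_group)
  define M where "M = matrix_inv T"
  define S where "S = M ** transpose M"
  have inv: "T ** M = mat 1" "M ** T = mat 1"
    using someI_ex[OF assms(3)[unfolded invertible_def]] by (simp_all add: M_def matrix_inv_def)
  have S: "transpose S = S" by (simp add: S_def matrix_transpose_mul)
  \<comment> \<open>The Schatten norms are traces of powers of \<open>transpose M ** M\<close>,
    while \<open>S\<close> is the product in the other order; cyclicity of the trace identifies
    them.\<close>
  have trS: "trace (transpose M ** M) = trace S" 
    unfolding S_def by (rule trace_mul_sym)
  have trSS: "trace ((transpose M ** M) ** (transpose M ** M)) = trace (S ** S)"
    using trace_mul_sym[of "transpose M" "M ** (transpose M ** M)"]
        by (simp add: S_def matrix_mul_assoc)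
  have trS_sum: "trace S = (\<Sum>i\<in>UNIV. \<Sum>j\<in>UNIV. (M$i$j)\<^sup>2)"
    by (simp add: S_def trace_def matrix_matrix_mult_def transpose_def power2_eq_square)
  \<comment> \<open>\<open>trace S\<close> is the sum of the squared entries of \<open>M\<close>,
    and M = 0 would contradict \<open>T ** M = mat 1\<close>.\<close>
  have "trace S \<noteq> 0"
  proof
    assume "trace S = 0"
    then have "M = 0"
      by (simp add: trS_sum sum_nonneg_eq_0_iff sum_nonneg vec_eq_iff)
    then have "(T ** M) $ undefined $ undefined = 0" by (simp add: matrix_matrix_mult_def)
    then show False by (simp add: inv mat_def)
  qed
  then have pos: "trace S > 0"
    using sum_nonneg[of UNIV "\<lambda>i. \<Sum>j\<in>UNIV. (M$i$j)\<^sup>2"] by (simp add: trS_sum sum_nonneg less_le)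
  have SS: "trace (S ** S) \<ge> 0"
    using S by (subst trace_square_symmetric) (auto simp: sum_nonneg vec_eq_iff transpose_def)
  have s2: "schatten2 M ^ 2 = trace S"
    using pos by (simp add: schatten2_def trS)
  have s24: "schatten2 M ^ 4 = (trace S)\<^sup>2"
    using s2 by (metis mult_2 numeral_Bit0 power2_eq_square power_add)
  have s4: "schatten4 M ^ 4 = trace (S ** S)"
    using SS by (simp add: schatten4_def trSS)
  \<comment> \<open>The ratio of the two coefficients in \<open>average_inequality\<close>.\<close>
  define K where "K = ((trace S)\<^sup>2 + 2 * trace (S ** S)) / ((real CARD('n) + 2) * trace S)"
  have K: "K > 0" using pos SS by (simp add: K_def add_pos_nonneg)
  let ?L = "buckling ((\<lambda>x. T *v x) ` \<Omega>)"
  have quotient: "?L \<le> K * (integral UNIV (\<lambda>x. (trace (H x))\<^sup>2) / integral UNIV (\<lambda>x. (norm (g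
      x))\<^sup>2))"
    if test: "C2_test \<Omega> u g H" and u: "u x0 \<noteq> 0" for u g H x0
  proof -
    note bs = C2_test_cont_bsupp[OF test]
    have cont: "continuous_on UNIV g" "continuous_on UNIV H"
        using bs by (auto simp: cont_bsupp_def)
    define P where "P = (\<lambda>i j. LINT x|lborel. g x$i * g x$j)"
    define Q where "Q = (\<lambda>i j k l. LINT x|lborel. H x$i$j * H x$k$l)"
    note sym = C2_test_hessian_symmetric[OF test]
    have "?L * (trace S / real CARD('n)) * (\<Sum>i\<in>UNIV. P i i) \<le> 
      ((trace S)\<^sup>2 + 2 * trace (S ** S)) / (real CARD('n) * (real CARD('n) + 2)) * (\<Sum>i\<in>UNIV.
          \<Sum>j\<in>UNIV. Q i i j j)"
    proof (rule average_inequality[where P = P and Q = Q, OF S])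
      show "Q i j k l = Q i j l k" for i j k l
        unfolding Q_def using sym by metis
      show "Q i j k l = Q i k j l" for i j k l
      proof -
        have "Q i j k l = (LINT x|lborel. H x$i$j * H x$l$k)" unfolding Q_def using sym by metis
        also have "\<dots> = (LINT x|lborel. H x$i$k * H x$l$j)"
            by (rule hessian_correlation_exchange[OF test])
        also have "\<dots> = Q i k j l" unfolding Q_def using sym by metis
        finally show ?thesis .
      qed
      show "?L * (\<Sum>i\<in>UNIV. \<Sum>j\<in>UNIV. R$i$j * P i j) \<le>
          (\<Sum>i\<in>UNIV. \<Sum>j\<in>UNIV. \<Sum>k\<in>UNIV. \<Sum>l\<in>UNIV. R$i$j * R$k$l * Q i j k l)"
        if U: "U \<in> sym_group \<Omega>" and R: "R = U ** S ** transpose U" for U R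
      proof -
        \<comment> \<open>The test function is u(U M y), so N = U M with inverse T U^t. Then N N^t =
          R, and T U^t maps \<Omega> onto T \<Omega> because U^t preserves \<Omega>.\<close>
        have UU: "transpose U ** U = mat 1" "U ** transpose U = mat 1"
          using orth[OF U] by (auto simp: orthogonal_matrix_def)
        have "(U ** M) ** (T ** transpose U) = U ** (M ** T) ** transpose U"
          by (simp add: matrix_mul_assoc)
        then have 1: "(U ** M) ** (T ** transpose U) = mat 1" by (simp add: inv UU)
        have "(T ** transpose U) ** (U ** M) = T ** (transpose U ** U) ** M"
          by (simp add: matrix_mul_assoc)
        then have 2: "(T ** transpose U) ** (U ** M) = mat 1" by (simp add: inv UU)
        have 3: "R = (U ** M) ** transpose (U ** M)"
          by (simp add: R S_def matrix_transpose_mul matrix_mul_assoc)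
        have "(\<lambda>x. (T ** transpose U) *v x) ` \<Omega> = (\<lambda>x. T *v x) ` (\<lambda>x. transpose U *v x) ` \<Omega>"
          by (simp add: image_image matrix_vector_mul_assoc del: transpose_matrix_vector)
        also have "\<dots> = (\<lambda>x. T *v x) ` \<Omega>"
          using transp[OF U] by (simp add: sym_group_def del: transpose_matrix_vector)
        finally have 4: "(\<lambda>x. (T ** transpose U) *v x) ` \<Omega> = (\<lambda>x. T *v x) ` \<Omega>" .
        show ?thesis
          using buckling_pullback_inequality[OF test u 1 2 3] unfolding 4 P_def Q_def .
      qed
    qed
    moreover have "(\<Sum>i\<in>UNIV. P i i) = (LINT x|lborel. (norm (g x))\<^sup>2)"
    proof -
      have "integrable lborel (\<lambda>x. g x$i * g x$i)" for i
        using bs(2) cont by (intro cont_bsupp_integrable cont_bsupp_mult cont_bsupp_nth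
            continuous_intros)
      then show ?thesis by (simp add: P_def power2_norm_eq_inner inner_vec_def integral_sum)
    qed
    moreover have "(\<Sum>i\<in>UNIV. \<Sum>j\<in>UNIV. Q i i j j) = (LINT x|lborel. (trace (H x))\<^sup>2)"
    proof -
      have "integrable lborel (\<lambda>x. H x$i$i * H x$j$j)" for i j
        using bs(3) cont by (intro cont_bsupp_integrable cont_bsupp_mult cont_bsupp_nth
            continuous_intros)
      then show ?thesis by (simp add: Q_def trace_def power2_eq_square sum_product integral_sum)
    qed
    ultimately have main: "?L * (trace S / real CARD('n)) * (LINT x|lborel. (norm (g x))\<^sup>2) \<le> 
      ((trace S)\<^sup>2 + 2 * trace (S ** S)) / (real CARD('n) * (real CARD('n) + 2)) * (LINT x|lborel.
          (trace (H x))\<^sup>2)"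
      by simp
    have gpos: "(LINT x|lborel. (norm (g x))\<^sup>2) > 0" by (rule gradient_energy_pos[OF test u])
    have "?L * (LINT x|lborel. (norm (g x))\<^sup>2) \<le> K * (LINT x|lborel. (trace (H x))\<^sup>2)"
    proof -
      have c: "trace S / real CARD('n) > 0" using pos by simp
      have "((trace S)\<^sup>2 + 2 * trace (S ** S)) / (real CARD('n) * (real CARD('n) + 2)) =
          K * (trace S / real CARD('n))"
        using pos by (simp add: K_def)
      with main have "(trace S / real CARD('n)) * (?L * (LINT x|lborel. (norm (g x))\<^sup>2)) \<le>
         (trace S / real CARD('n)) * (K * (LINT x|lborel. (trace (H x))\<^sup>2))"
        by (simp only: mult_ac)
      then show ?thesis using c by (simp only: mult_le_cancel_left_pos)
    qed
    then show ?thesis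
      using gpos by (simp add: integral_UNIV_eq_lborel C2_test_energies[OF test] field_simps)
  qed
  \<comment> \<open>Dividing by \<open>K\<close> turns the bound on every quotient into a lower
    bound for their infimum.\<close>
  have "?L / K \<le> buckling \<Omega>"
    unfolding buckling_def[of \<Omega>]
  proof (rule cInf_greatest)
    show "{integral UNIV (\<lambda>x. (trace (H x))\<^sup>2) / integral UNIV (\<lambda>x. (norm (g x))\<^sup>2)
        | u g H. C2_test \<Omega> u g H \<and> (\<exists>x. u x \<noteq> 0)} \<noteq> {}"
    proof -
      have "open \<Omega>" "\<Omega> \<noteq> {}" using assms(1) by (simp_all add: bounded_domain_def)
      then obtain u g H x0 where "C2_test \<Omega> u g H" "u x0 \<noteq> 0" by (rule C2_test_exists)
      then show ?thesis by blast
    qed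
  next
    fix q
    assume "q \<in> {integral UNIV (\<lambda>x. (trace (H x))\<^sup>2) / integral UNIV (\<lambda>x. (norm (g x))\<^sup>2)
        | u g H. C2_test \<Omega> u g H \<and> (\<exists>x. u x \<noteq> 0)}"
    then have "?L \<le> K * q" using quotient by blast
    then show "?L / K \<le> q" using K by (simp add: pos_divide_le_eq mult.commute)
  qed
  then have "?L \<le> K * buckling \<Omega>" using K by (simp add: pos_divide_le_eq mult.commute)
  then show ?thesis
    unfolding K_def M_def[symmetric] s2 s24 s4 .
qed

end
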